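(* Let $\mathcal A$ be a set of $m\ge4$ alternatives, let $a\in\mathcal A$, let $0<\varphi<1/m$, and consider Mallows' model with dispersion $\varphi$ and $n=1$. Then there exists $0<\alpha<1$ such that no level-$\alpha$ UMP test exists for $H_0=\mathcal L(\mathcal A)\setminus H_1$ vs. $H_1=L_{a\succ\text{others}}$.
   Context: $\mathcal L(\mathcal A)$ is the set of all linear orders (rankings) over $\mathcal A$. $L_{a\succ\text{others}}$ is the set of rankings in which $a$ is ranked at the top. The Kendall-tau distance $\mathrm{KT}(V,W)$ is the number of unordered pairs of alternatives on which $V$ and $W$ disagree. Mallows' model with fixed dispersion $\varphi$ and $n=1$: sample space $\mathcal L(\mathcal A)$, parameter space $\mathcal L(\mathcal A)$, $\pi_W(V)=\frac1Z\varphi^{\mathrm{KT}(V,W)}$, $Z$ the normalization factor. Testing: for disjoint sets of parameters $H_0,H_1$, a (randomized) test is a function $f$ from the sample space to $[0,1]$ ($f(P)$ is the probability of rejecting $H_0$). $\mathrm{Size}(f,h_0)=E_{P\sim\pi_{h_0}}f(P)$, $\mathrm{Size}(f)=\sup_{h_0\in H_0}\mathrm{Size}(f,h_0)$, and $\mathrm{Power}(f,h_1)=E_{P\sim\pi_{h_1}}f(P)$ for $h_1\in H_1$. A level-$\alpha$ uniformly most powerful (UMP) test for $H_0$ vs. $H_1$ is a test $f$ with $\mathrm{Size}(f)=\alpha$ such that for every $h_1\in H_1$ and every test $g$ with $\mathrm{Size}(g)\le\alpha$, $\mathrm{Power}(f,h_1)\ge\mathrm{Power}(g,h_1)$. *)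

theory Defs
  imports "HOL-Probability.Probability_Mass_Function"
begin

text \<open>A ranking of \<open>A\<close> is a (reflexive) linear order on \<open>A\<close>; \<open>(x, y) \<in> V\<close> with \<open>x \<noteq> y\<close>
  is read as ``\<open>V\<close> ranks \<open>x\<close> above \<open>y\<close>''.\<close>

definition rankings :: "'a set \<Rightarrow> 'a rel set" where
  "rankings A = {V. linear_order_on A V}"

definition top_rankings :: "'a set \<Rightarrow> 'a \<Rightarrow> 'a rel set" where
  "top_rankings A a = {V \<in> rankings A. \<forall>b \<in> A - {a}. (a, b) \<in> V}"

text \<open>Only one of the two directions of a pair needs to be compared: for linear orders \<open>V\<close>, \<open>W\<close>
  on \<open>A\<close> and distinct \<open>x, y \<in> A\<close>, disagreement on \<open>(x, y)\<close> is the same as disagreement on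
  \<open>(y, x)\<close>.\<close>

definition kendall_tau :: "'a set \<Rightarrow> 'a rel \<Rightarrow> 'a rel \<Rightarrow> nat" where
  "kendall_tau A V W =
     card {{x, y} | x y. x \<in> A \<and> y \<in> A \<and> x \<noteq> y \<and> ((x, y) \<in> V \<longleftrightarrow> (x, y) \<notin> W)}"

lemma finite_rankings: "finite A \<Longrightarrow> finite (rankings A)"
  by (rule finite_subset[of _ "Pow (A \<times> A)"])
     (auto simp: rankings_def order_on_defs)

definition mallows_norm :: "'a set \<Rightarrow> real \<Rightarrow> 'a rel \<Rightarrow> real" where
  "mallows_norm A \<phi> W = (\<Sum>V\<in>rankings A. \<phi> ^ kendall_tau A V W)"

definition mallows :: "'a set \<Rightarrow> real \<Rightarrow> 'a rel \<Rightarrow> 'a rel pmf" where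
  "mallows A \<phi> W = embed_pmf
     (\<lambda>V. if V \<in> rankings A then \<phi> ^ kendall_tau A V W / mallows_norm A \<phi> W else 0)"

text \<open>The weights do form a probability mass function, so \<open>embed_pmf\<close> yields the intended
  distribution.\<close>

lemma pmf_mallows:
  assumes "finite A" "0 < \<phi>" "W \<in> rankings A"
  shows "pmf (mallows A \<phi> W) V =
    (if V \<in> rankings A then \<phi> ^ kendall_tau A V W / mallows_norm A \<phi> W else 0)"
proof -
  let ?p = "\<lambda>V. if V \<in> rankings A then \<phi> ^ kendall_tau A V W / mallows_norm A \<phi> W else 0"
  have fin: "finite (rankings A)"
    using assms(1) by (rule finite_rankings)
  have pos: "mallows_norm A \<phi> W > 0"
    unfolding mallows_norm_def using fin assms by (intro sum_pos) auto
  have nonneg: "?p V \<ge> 0" for V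
    using pos assms(2) by simp
  have "(\<Sum>V\<in>rankings A. ?p V) = (\<Sum>V\<in>rankings A. \<phi> ^ kendall_tau A V W) / mallows_norm A \<phi> W"
    by (simp add: sum_divide_distrib)
  then have sum1: "(\<Sum>V\<in>rankings A. ?p V) = 1"
    using pos by (simp add: mallows_norm_def)
  have "(\<integral>\<^sup>+ V. ennreal (?p V) \<partial>count_space UNIV) = (\<Sum>V\<in>rankings A. ennreal (?p V))"
    using fin by (intro nn_integral_count_space') auto
  also have "\<dots> = ennreal (\<Sum>V\<in>rankings A. ?p V)"
    using nonneg by (rule sum_ennreal)
  finally have "(\<integral>\<^sup>+ V. ennreal (?p V) \<partial>count_space UNIV) = 1"
    by (simp only: sum1 ennreal_1)
  with nonneg show ?thesis
    unfolding mallows_def by (rule pmf_embed_pmf)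
qed

lemma set_pmf_mallows:
  assumes "finite A" "0 < \<phi>" "W \<in> rankings A"
  shows "set_pmf (mallows A \<phi> W) = rankings A"
proof -
  have "mallows_norm A \<phi> W > 0"
    unfolding mallows_norm_def using finite_rankings[OF assms(1)] assms by (intro sum_pos) auto
  with assms show ?thesis
    by (auto simp: set_pmf_eq pmf_mallows)
qed

text \<open>\<open>S\<close> is the sample space, \<open>\<pi>\<close> the family of distributions on \<open>S\<close> indexed by the
  parameters, and \<open>f P\<close> the probability of rejecting the null hypothesis on observing \<open>P\<close>.\<close>

definition is_test :: "'s set \<Rightarrow> ('s \<Rightarrow> real) \<Rightarrow> bool" where
  "is_test S f \<longleftrightarrow> (\<forall>P\<in>S. 0 \<le> f P \<and> f P \<le> 1)"

definition size_at :: "('p \<Rightarrow> 's pmf) \<Rightarrow> ('s \<Rightarrow> real) \<Rightarrow> 'p \<Rightarrow> real" where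
  "size_at \<pi> f h\<^sub>0 = measure_pmf.expectation (\<pi> h\<^sub>0) f"

definition test_size :: "('p \<Rightarrow> 's pmf) \<Rightarrow> 'p set \<Rightarrow> ('s \<Rightarrow> real) \<Rightarrow> real" where
  "test_size \<pi> H\<^sub>0 f = (SUP h\<^sub>0\<in>H\<^sub>0. size_at \<pi> f h\<^sub>0)"

definition test_power :: "('p \<Rightarrow> 's pmf) \<Rightarrow> ('s \<Rightarrow> real) \<Rightarrow> 'p \<Rightarrow> real" where
  "test_power \<pi> f h\<^sub>1 = measure_pmf.expectation (\<pi> h\<^sub>1) f"

definition is_UMP_test ::
  "'s set \<Rightarrow> ('p \<Rightarrow> 's pmf) \<Rightarrow> 'p set \<Rightarrow> 'p set \<Rightarrow> real \<Rightarrow> ('s \<Rightarrow> real) \<Rightarrow> bool" where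
  "is_UMP_test S \<pi> H\<^sub>0 H\<^sub>1 \<alpha> f \<longleftrightarrow>
     is_test S f \<and> test_size \<pi> H\<^sub>0 f = \<alpha> \<and>
     (\<forall>h\<^sub>1\<in>H\<^sub>1. \<forall>g. is_test S g \<and> test_size \<pi> H\<^sub>0 g \<le> \<alpha> \<longrightarrow>
        test_power \<pi> f h\<^sub>1 \<ge> test_power \<pi> g h\<^sub>1)"

end

theory Submission
  imports Defs
begin

text \<open>Why no test is uniformly most powerful at some level: a test that is good for all rankings with \<open>a\<close>
  on top simultaneously has to treat them alike, while a test built for one such ranking \<open>W\<close> can
  do slightly better at \<open>W\<close>.

  Let \<open>z\<close> be the unnormalized weight that a parameter in \<open>top_rankings A a\<close> gives to
  \<open>top_rankings A a\<close>, and \<open>Z\<close> the normalization factor; both are the same for all such parameters,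
  since permuting \<open>A - {a}\<close> preserves the distance. The level is
  \<open>\<alpha> = (\<phi> * z + t) / Z\<close>: rejecting whenever \<open>a\<close> is on top has size
  \<open>\<phi> * z / Z\<close>, which leaves a budget \<open>t\<close> for rejecting other rankings. Put
  \<open>Y = \<phi> + \<dots> + \<phi> ^ (m - 1)\<close>.

  Upper bound (\<open>test_power_gain_bound\<close>). Sum the constraint on the size over all null parameters with
  \<open>a\<close> in second place, and the power over the matching alternatives, where \<open>a\<close> is exchanged with the
  leader. Among the sample points outside \<open>top_rankings A a\<close> the ratio of the summed
  likelihoods is at most \<open>Y / (1 - \<phi>\<^sup>2 + \<phi> * Y)\<close>
  (\<open>alternative_weight_le_null_weight\<close>). Hence, by a weighing as in the Neyman-Pearson lemma, a test of
  size at most \<open>\<alpha>\<close> cannot have power at least \<open>(z + G) / Z\<close> at all alternatives unless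
  \<open>G \<le> Y * t / (1 - \<phi>\<^sup>2 + \<phi> * Y)\<close>.

  Competitor (\<open>sparse_test\<close>). For a fixed alternative \<open>W\<close>, reject on \<open>top_rankings A a\<close> and, with
  probability \<open>x k\<close>, on the ranking obtained from \<open>W\<close> by lifting its alternative of rank \<open>k \<ge> 1\<close> to the
  top. This ranking has distance \<open>k\<close> from \<open>W\<close>, so the power is \<open>(z + G) / Z\<close> with \<open>G = (\<Sum>k=1..m-1. x k * \<phi> ^ k)\<close>.
  The lifted rankings for \<open>k\<close> and \<open>l\<close> have distance at least \<open>k + l\<close>, so the size constraints amount to
  \<open>x k * (1 - \<phi> ^ (2 * k)) + \<phi> ^ k * G \<le> t\<close>, together with \<open>\<phi> * (\<Sum>k=1..m-1. x k) \<le> t\<close>,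
  which is easy to meet because \<open>\<phi> * m < 1\<close>. Constant \<open>x\<close> exactly reaches the upper bound and leaves slack
  in the constraints for \<open>k \<ge> 2\<close> as soon as \<open>m \<ge> 4\<close>; using this slack for \<open>k = 2\<close> gives strictly
  more (\<open>exists_weights\<close>). So the competitors at the various \<open>W\<close> cannot all be matched by one test.\<close>

section \<open>Rankings and their distance\<close>

lemma rankings_subset: "V \<in> rankings A \<Longrightarrow> V \<subseteq> A \<times> A"
  by (auto simp: rankings_def order_on_defs)

lemma rankings_refl: "V \<in> rankings A \<Longrightarrow> x \<in> A \<Longrightarrow> (x, x) \<in> V"
  by (auto simp: rankings_def order_on_defs refl_on_def)

lemma rankings_antisym: "V \<in> rankings A \<Longrightarrow> (x, y) \<in> V \<Longrightarrow> (y, x) \<in> V \<Longrightarrow> x = y"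
  by (auto simp: rankings_def order_on_defs antisym_def)

lemma rankings_trans: "V \<in> rankings A \<Longrightarrow> (x, y) \<in> V \<Longrightarrow> (y, z) \<in> V \<Longrightarrow> (x, z) \<in> V"
  by (auto simp: rankings_def order_on_defs trans_def)

lemma rankings_total: "V \<in> rankings A \<Longrightarrow> x \<in> A \<Longrightarrow> y \<in> A \<Longrightarrow> (x, y) \<notin> V \<Longrightarrow> (y, x) \<in> V"
  by (cases "x = y") (auto simp: rankings_def order_on_defs total_on_def refl_on_def)

lemma finite_ranking: "finite A \<Longrightarrow> V \<in> rankings A \<Longrightarrow> finite V"
  using rankings_subset[of V A] by (meson finite_SigmaI finite_subset)

lemma rankings_eqI:
  assumes "V \<in> rankings A" "W \<in> rankings A" "V \<subseteq> W"
  shows "V = W"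
proof (rule equalityI[OF assms(3)], rule subsetI)
  fix p assume p: "p \<in> W"
  obtain x y where xy: "p = (x, y)" by force
  have "x \<in> A" "y \<in> A" using p xy rankings_subset[OF assms(2)] by auto
  moreover have "x = y" if "(x, y) \<notin> V"
    using rankings_total[OF assms(1) calculation that] assms(2,3) p xy
    by (auto dest: rankings_antisym)
  ultimately show "p \<in> V" using xy rankings_refl[OF assms(1)] by auto
qed

lemma rankingsI:
  assumes "V \<subseteq> A \<times> A" "\<And>x. x \<in> A \<Longrightarrow> (x, x) \<in> V"
    "\<And>x y. (x, y) \<in> V \<Longrightarrow> (y, x) \<in> V \<Longrightarrow> x = y"
    "\<And>x y z. (x, y) \<in> V \<Longrightarrow> (y, z) \<in> V \<Longrightarrow> (x, z) \<in> V"
    "\<And>x y. x \<in> A \<Longrightarrow> y \<in> A \<Longrightarrow> (x, y) \<in> V \<or> (y, x) \<in> V"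
  shows "V \<in> rankings A"
  unfolding rankings_def order_on_defs
  using assms by (auto simp: refl_on_def antisym_def trans_def total_on_def)

text \<open>For two rankings each disagreeing pair contributes exactly one ordered pair to \<open>V - W\<close>.
  In this form the distance can be computed with set operations on relations.\<close>

lemma kendall_tau_eq_card_Diff:
  assumes V: "V \<in> rankings A" and W: "W \<in> rankings A"
  shows "kendall_tau A V W = card (V - W)"
proof -
  let ?P = "{{x, y} | x y. x \<in> A \<and> y \<in> A \<and> x \<noteq> y \<and> ((x, y) \<in> V \<longleftrightarrow> (x, y) \<notin> W)}"
  have mem: "x \<in> A \<and> y \<in> A \<and> x \<noteq> y" if "(x, y) \<in> V - W" for x y
    using that rankings_subset[OF V] rankings_refl[OF W, of x] by auto
  have inj: "inj_on (\<lambda>(x, y). {x, y}) (V - W)"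
  proof (rule inj_onI)
    fix p q assume *: "p \<in> V - W" "q \<in> V - W" "(\<lambda>(x, y). {x, y}) p = (\<lambda>(x, y). {x, y}) q"
    obtain x y u v where pq: "p = (x, y)" "q = (u, v)" by (cases p, cases q) blast
    with * have "x = u \<and> y = v \<or> x = v \<and> y = u" by (simp add: doubleton_eq_iff)
    then show "p = q"
      using * pq rankings_antisym[OF V, of x y] by auto
  qed
  have img: "(\<lambda>(x, y). {x, y}) ` (V - W) = ?P"
  proof (intro equalityI subsetI)
    fix p assume "p \<in> (\<lambda>(x, y). {x, y}) ` (V - W)"
    then obtain x y where xy: "p = {x, y}" "(x, y) \<in> V - W" by auto
    then show "p \<in> ?P" using mem[OF xy(2)] by blast
  next
    fix p assume "p \<in> ?P"
    then obtain x y where xy: "p = {x, y}" "x \<in> A" "y \<in> A" "x \<noteq> y"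
      "(x, y) \<in> V \<longleftrightarrow> (x, y) \<notin> W" by blast
    have "(x, y) \<in> V - W \<or> (y, x) \<in> V - W"
    proof (cases "(x, y) \<in> V")
      case False
      then have "(y, x) \<in> V" using rankings_total[OF V xy(2,3)] by simp
      moreover have "(y, x) \<notin> W" using False xy(4,5) rankings_antisym[OF W, of x y] by auto
      ultimately show ?thesis by simp
    qed (use xy(5) in simp)
    then show "p \<in> (\<lambda>(x, y). {x, y}) ` (V - W)"
    proof
      assume "(x, y) \<in> V - W"
      then show ?thesis unfolding xy(1) by (rule rev_image_eqI) simp
    next
      assume "(y, x) \<in> V - W"
      then show ?thesis unfolding xy(1) by (rule rev_image_eqI) (simp add: insert_commute)
    qed
  qed
  show ?thesis
    unfolding kendall_tau_def img[symmetric] by (rule card_image[OF inj])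
qed

lemma top_rankings_iff:
  "V \<in> top_rankings A a \<longleftrightarrow> V \<in> rankings A \<and> (\<forall>x\<in>A. x \<noteq> a \<longrightarrow> (a, x) \<in> V)"
  by (auto simp: top_rankings_def)

lemma top_rankings_subset: "top_rankings A a \<subseteq> rankings A"
  by (auto simp: top_rankings_def)

lemma kendall_tau_triangle:
  assumes "finite A" "V \<in> rankings A" "U \<in> rankings A" "W \<in> rankings A"
  shows "kendall_tau A V W \<le> kendall_tau A V U + kendall_tau A U W"
proof -
  have "card (V - W) \<le> card ((V - U) \<union> (U - W))"
    using assms by (intro card_mono) (auto simp: finite_ranking)
  also have "\<dots> \<le> card (V - U) + card (U - W)" by (rule card_Un_le)
  finally show ?thesis using assms by (simp add: kendall_tau_eq_card_Diff)
qed

lemma kendall_tau_eq_0_imp: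
  assumes "finite A" "V \<in> rankings A" "W \<in> rankings A" "kendall_tau A V W = 0"
  shows "V = W"
proof -
  have "card (V - W) = 0" using assms by (simp add: kendall_tau_eq_card_Diff)
  then have "V - W = {}" using finite_ranking[OF assms(1,2)] by simp
  then show ?thesis by (intro rankings_eqI[OF assms(2,3)]) blast
qed

section \<open>Ranks and lifting an alternative to the top\<close>

text \<open>Ranks start at 0. By totality, the alternatives \<open>y\<close> counted here are those strictly above \<open>c\<close>.\<close>

definition rank_of :: "'a set \<Rightarrow> 'a rel \<Rightarrow> 'a \<Rightarrow> nat" where
  "rank_of A W c = card {y \<in> A. (c, y) \<notin> W}"

lemma rank_of_le_iff:
  assumes "finite A" "W \<in> rankings A" "x \<in> A" "y \<in> A"
  shows "rank_of A W x \<le> rank_of A W y \<longleftrightarrow> (x, y) \<in> W"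
proof
  assume "(x, y) \<in> W"
  then show "rank_of A W x \<le> rank_of A W y"
    unfolding rank_of_def using assms
    by (intro card_mono) (auto dest: rankings_trans)
next
  assume le: "rank_of A W x \<le> rank_of A W y"
  show "(x, y) \<in> W"
  proof (rule ccontr)
    assume n: "(x, y) \<notin> W"
    then have yx: "(y, x) \<in> W" using rankings_total assms by metis
    have "{z \<in> A. (y, z) \<notin> W} \<subset> {z \<in> A. (x, z) \<notin> W}"
      using assms n yx rankings_refl[OF assms(2)] rankings_trans[OF assms(2)] by blast
    then have "rank_of A W y < rank_of A W x"
      unfolding rank_of_def using assms by (intro psubset_card_mono) auto
    with le show False by simp
  qed
qed

lemma bij_betw_rank_of:
  assumes "finite A" "W \<in> rankings A"
  shows "bij_betw (rank_of A W) A {..<card A}"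
proof -
  have inj: "inj_on (rank_of A W) A"
  proof (rule inj_onI)
    fix x y assume xy: "x \<in> A" "y \<in> A" "rank_of A W x = rank_of A W y"
    then have "(x, y) \<in> W" "(y, x) \<in> W" using rank_of_le_iff[OF assms, of x y] rank_of_le_iff[OF assms, of y x] by auto
    then show "x = y" using rankings_antisym[OF assms(2)] by blast
  qed
  have "rank_of A W ` A \<subseteq> {..<card A}"
  proof clarsimp
    fix x assume x: "x \<in> A"
    then have "{y \<in> A. (x, y) \<notin> W} \<subset> A" using rankings_refl[OF assms(2)] by auto
    then show "rank_of A W x < card A"
      unfolding rank_of_def using assms(1) by (rule psubset_card_mono[rotated])
  qed
  then have "rank_of A W ` A = {..<card A}"
    using inj by (intro card_subset_eq) (auto simp: card_image)
  then show ?thesis using inj by (simp add: bij_betw_def)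
qed

lemma rank_of_top:
  assumes "W \<in> top_rankings A a" "a \<in> A"
  shows "rank_of A W a = 0"
proof -
  have "{y \<in> A. (a, y) \<notin> W} = {}"
    using assms rankings_refl[of W A a] by (auto simp: top_rankings_iff)
  then show ?thesis by (simp only: rank_of_def card.empty)
qed

lemma bij_betw_rank_of_top:
  assumes "finite A" "a \<in> A" "W \<in> top_rankings A a"
  shows "bij_betw (rank_of A W) (A - {a}) {1..card A - 1}"
proof -
  have W: "W \<in> rankings A" using assms by (auto simp: top_rankings_iff)
  have "bij_betw (rank_of A W) (A - {a}) ({..<card A} - {rank_of A W a})"
    using bij_betw_rank_of[OF assms(1) W] assms(2) by (auto simp: bij_betw_def inj_on_def)
  moreover have "{..<card A} - {rank_of A W a} = {1..card A - 1}"
    by (auto simp: rank_of_top[OF assms(3,2)])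
  ultimately show ?thesis by simp
qed

definition move_top :: "'a set \<Rightarrow> 'a \<Rightarrow> 'a rel \<Rightarrow> 'a rel" where
  "move_top A c W = {c} \<times> A \<union> {(x, y) \<in> W. y \<noteq> c}"

lemma move_top_in_top_rankings:
  assumes "W \<in> rankings A" "c \<in> A"
  shows "move_top A c W \<in> top_rankings A c"
proof -
  note f = rankings_subset[OF assms(1)] rankings_refl[OF assms(1)] rankings_total[OF assms(1)]
  have "move_top A c W \<in> rankings A"
  proof (rule rankingsI)
    show "move_top A c W \<subseteq> A \<times> A" using f assms by (auto simp: move_top_def)
    show "(x, x) \<in> move_top A c W" if "x \<in> A" for x
      using f assms that by (auto simp: move_top_def)
    show "x = y" if "(x, y) \<in> move_top A c W" "(y, x) \<in> move_top A c W" for x y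
      using that rankings_antisym[OF assms(1)] by (auto simp: move_top_def)
    show "(x, z) \<in> move_top A c W" if "(x, y) \<in> move_top A c W" "(y, z) \<in> move_top A c W" for x y z
      using that rankings_trans[OF assms(1), of x y z] f(1) by (auto simp: move_top_def)
    show "(x, y) \<in> move_top A c W \<or> (y, x) \<in> move_top A c W" if "x \<in> A" "y \<in> A" for x y
      using that f(3)[of x y] by (auto simp: move_top_def)
  qed
  then show ?thesis using assms by (auto simp: top_rankings_iff move_top_def)
qed

lemma move_top_in_rankings:
  "W \<in> rankings A \<Longrightarrow> c \<in> A \<Longrightarrow> move_top A c W \<in> rankings A"
  by (rule subsetD[OF top_rankings_subset move_top_in_top_rankings])

text \<open>If \<open>V\<close> has \<open>c\<close> on top, then \<open>V\<close> disagrees with \<open>W\<close> on \<open>c\<close> versus \<open>y\<close> exactly for the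
  alternatives \<open>y\<close> above \<open>c\<close> in \<open>W\<close>; lifting \<open>c\<close> in \<open>W\<close> repairs these pairs and touches no other.\<close>

lemma kendall_tau_move_top:
  assumes "finite A" "c \<in> A" "V \<in> top_rankings A c" "W \<in> rankings A"
  shows "kendall_tau A V W = kendall_tau A V (move_top A c W) + rank_of A W c"
proof -
  have V: "V \<in> rankings A" "\<And>x. x \<in> A \<Longrightarrow> (c, x) \<in> V"
    using assms rankings_refl[of V A] by (auto simp: top_rankings_iff)
  have only: "x = c" if "(x, c) \<in> V" for x
    using that V rankings_antisym[OF V(1)] rankings_subset[OF V(1)] by blast
  let ?B = "Pair c ` {y \<in> A. (c, y) \<notin> W}"
  have "V - W = (V - move_top A c W) \<union> ?B"
  proof (intro equalityI subsetI)
    fix p assume "p \<in> V - W"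
    then show "p \<in> (V - move_top A c W) \<union> ?B"
      using rankings_subset[OF V(1)] by (cases p) (auto simp: move_top_def)
  next
    fix p assume "p \<in> (V - move_top A c W) \<union> ?B"
    then show "p \<in> V - W"
      using V(2) only rankings_subset[OF V(1)] by (cases p) (auto simp: move_top_def)
  qed
  moreover have "(V - move_top A c W) \<inter> ?B = {}" by (auto simp: move_top_def)
  ultimately have "card (V - W) = card (V - move_top A c W) + card ?B"
    using assms(1) finite_ranking[OF assms(1) V(1)] by (simp add: card_Un_disjoint)
  moreover have "card ?B = rank_of A W c"
    by (simp add: rank_of_def card_image inj_on_def)
  ultimately show ?thesis
    using V assms by (simp add: kendall_tau_eq_card_Diff move_top_in_rankings)
qed

lemma kendall_tau_self: "V \<in> rankings A \<Longrightarrow> kendall_tau A V V = 0"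
  by (simp add: kendall_tau_eq_card_Diff)

lemma kendall_tau_move_top_self:
  assumes "finite A" "c \<in> A" "W \<in> rankings A"
  shows "kendall_tau A (move_top A c W) W = rank_of A W c"
  using kendall_tau_move_top[OF assms(1,2) move_top_in_top_rankings[OF assms(3,2)] assms(3)]
  by (simp add: kendall_tau_self move_top_in_rankings assms)

text \<open>The pairs broken by lifting \<open>c\<close> and those broken by lifting \<open>c'\<close> could only have \<open>{c, c'}\<close>
  in common, and this pair is broken only by the lift of the lower one of the two.\<close>

lemma kendall_tau_move_top_move_top_ge:
  assumes "finite A" "c \<in> A" "c' \<in> A" "c \<noteq> c'" "W \<in> rankings A"
  shows "rank_of A W c + rank_of A W c' \<le> kendall_tau A (move_top A c W) (move_top A c' W)"
proof -
  let ?B = "Pair c ` {y \<in> A. (c, y) \<notin> W}" and ?B' = "(\<lambda>x. (x, c')) ` {x \<in> A. (c', x) \<notin> W}"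
  have "?B \<union> ?B' \<subseteq> move_top A c W - move_top A c' W"
  proof
    fix p assume "p \<in> ?B \<union> ?B'"
    then show "p \<in> move_top A c W - move_top A c' W"
    proof
      assume "p \<in> ?B"
      then show ?thesis using assms(4) by (auto simp: move_top_def)
    next
      assume "p \<in> ?B'"
      then obtain x where x: "p = (x, c')" "x \<in> A" "(c', x) \<notin> W" by blast
      then have "(x, c') \<in> W" "x \<noteq> c'"
        using rankings_total[OF assms(5,3)] rankings_refl[OF assms(5,3)] by auto
      then show ?thesis using x assms(4) by (auto simp: move_top_def)
    qed
  qed
  then have "card (?B \<union> ?B') \<le> kendall_tau A (move_top A c W) (move_top A c' W)"
    unfolding kendall_tau_eq_card_Diff[OF move_top_in_rankings[OF assms(5,2)]
        move_top_in_rankings[OF assms(5,3)]]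
    by (rule card_mono[rotated])
      (simp add: finite_ranking[OF assms(1) move_top_in_rankings[OF assms(5,2)]])
  moreover have "?B \<inter> ?B' = {}" using rankings_total[OF assms(5,2,3)] by blast
  then have "card (?B \<union> ?B') = card ?B + card ?B'"
    using assms(1) by (intro card_Un_disjoint) auto
  moreover have "card ?B = rank_of A W c" "card ?B' = rank_of A W c'"
    by (simp_all add: rank_of_def card_image inj_on_def)
  ultimately show ?thesis by simp
qed

section \<open>Invariance of Mallows weights under relabelling\<close>

definition relabel :: "'a set \<Rightarrow> ('a \<Rightarrow> 'a) \<Rightarrow> 'a rel \<Rightarrow> 'a rel" where
  "relabel A \<tau> V = {(x, y) \<in> A \<times> A. (\<tau> x, \<tau> y) \<in> V}"

lemma relabel_in_rankings:
  assumes "bij_betw \<tau> A A" "V \<in> rankings A"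
  shows "relabel A \<tau> V \<in> rankings A"
proof (rule rankingsI)
  note \<tau> = bij_betwE[OF assms(1)] and inj = bij_betw_imp_inj_on[OF assms(1)]
  show "relabel A \<tau> V \<subseteq> A \<times> A" by (auto simp: relabel_def)
  show "(x, x) \<in> relabel A \<tau> V" if "x \<in> A" for x
    using that \<tau> rankings_refl[OF assms(2)] by (simp add: relabel_def)
  show "x = y" if "(x, y) \<in> relabel A \<tau> V" "(y, x) \<in> relabel A \<tau> V" for x y
    using that rankings_antisym[OF assms(2), of "\<tau> x" "\<tau> y"] inj
    by (simp add: relabel_def inj_on_def)
  show "(x, z) \<in> relabel A \<tau> V" if "(x, y) \<in> relabel A \<tau> V" "(y, z) \<in> relabel A \<tau> V" for x y z
    using that rankings_trans[OF assms(2), of "\<tau> x" "\<tau> y" "\<tau> z"] by (simp add: relabel_def)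
  show "(x, y) \<in> relabel A \<tau> V \<or> (y, x) \<in> relabel A \<tau> V" if "x \<in> A" "y \<in> A" for x y
    using that \<tau> rankings_total[OF assms(2), of "\<tau> x" "\<tau> y"] by (auto simp: relabel_def)
qed

lemma relabel_image:
  assumes "bij_betw \<tau> A A" "V \<subseteq> A \<times> A"
  shows "map_prod \<tau> \<tau> ` relabel A \<tau> V = V"
proof (intro equalityI subsetI)
  fix p assume p: "p \<in> V"
  obtain x y where xy: "p = (x, y)" by (cases p)
  then have "x \<in> \<tau> ` A" "y \<in> \<tau> ` A" using p assms by (auto simp: bij_betw_def)
  then obtain u v where "u \<in> A" "v \<in> A" "x = \<tau> u" "y = \<tau> v" by blast
  then show "p \<in> map_prod \<tau> \<tau> ` relabel A \<tau> V"
    using p xy by (intro image_eqI[of _ _ "(u, v)"]) (auto simp: relabel_def)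
qed (auto simp: relabel_def)

lemma kendall_tau_relabel:
  assumes "bij_betw \<tau> A A" "V \<in> rankings A" "W \<in> rankings A"
  shows "kendall_tau A (relabel A \<tau> V) (relabel A \<tau> W) = kendall_tau A V W"
proof -
  have inj: "inj_on (map_prod \<tau> \<tau>) (A \<times> A)"
    using map_prod_inj_on bij_betw_imp_inj_on[OF assms(1)] by blast
  have "relabel A \<tau> V - relabel A \<tau> W = relabel A \<tau> (V - W)"
    by (auto simp: relabel_def)
  moreover have "card (relabel A \<tau> (V - W)) = card (V - W)"
  proof -
    have "inj_on (map_prod \<tau> \<tau>) (relabel A \<tau> (V - W))"
      by (rule inj_on_subset[OF inj]) (auto simp: relabel_def)
    moreover have "V - W \<subseteq> A \<times> A" using rankings_subset[OF assms(2)] by blast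
    ultimately show ?thesis using card_image relabel_image[OF assms(1)] by metis
  qed
  ultimately show ?thesis
    using assms by (simp add: kendall_tau_eq_card_Diff relabel_in_rankings)
qed

text \<open>The unnormalized Mallows mass that the parameter \<open>W\<close> gives to the event \<open>S\<close>.\<close>

definition mallows_weight :: "'a set \<Rightarrow> real \<Rightarrow> 'a rel set \<Rightarrow> 'a rel \<Rightarrow> real" where
  "mallows_weight A \<phi> S W = (\<Sum>V\<in>S. \<phi> ^ kendall_tau A V W)"

lemma mallows_weight_relabel:
  assumes "finite A" "bij_betw \<tau> A A" "W \<in> rankings A"
    "S \<subseteq> rankings A" "relabel A \<tau> ` S \<subseteq> S"
  shows "mallows_weight A \<phi> S (relabel A \<tau> W) = mallows_weight A \<phi> S W"
proof -
  have fin: "finite S" using assms(1,4) finite_rankings finite_subset by blast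
  have inj: "inj_on (relabel A \<tau>) S"
  proof (rule inj_onI)
    fix V V' assume *: "V \<in> S" "V' \<in> S" "relabel A \<tau> V = relabel A \<tau> V'"
    then have "V \<subseteq> A \<times> A" "V' \<subseteq> A \<times> A" using assms(4) rankings_subset by blast+
    then show "V = V'" using relabel_image[OF assms(2)] *(3) by metis
  qed
  have "bij_betw (relabel A \<tau>) S S"
    using endo_inj_surj[OF fin assms(5) inj] inj by (simp add: bij_betw_def)
  then have "mallows_weight A \<phi> S (relabel A \<tau> W) =
      (\<Sum>V\<in>S. \<phi> ^ kendall_tau A (relabel A \<tau> V) (relabel A \<tau> W))"
    unfolding mallows_weight_def by (rule sum.reindex_bij_betw[symmetric])
  also have "\<dots> = mallows_weight A \<phi> S W"
    unfolding mallows_weight_def using assms by (intro sum.cong) (auto simp: kendall_tau_relabel)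
  finally show ?thesis .
qed

text \<open>Any two rankings of a finite set are isomorphic. Preservation of ranks is recorded in order to see
  that the isomorphism of two rankings with the same leader fixes this leader.\<close>

lemma exists_relabelling:
  assumes "finite A" "W \<in> rankings A" "W' \<in> rankings A"
  obtains \<tau> where "bij_betw \<tau> A A" "relabel A \<tau> W = W'"
    "\<And>x. x \<in> A \<Longrightarrow> rank_of A W (\<tau> x) = rank_of A W' x"
proof -
  \<comment> \<open>Match the alternatives by their ranks.\<close>
  define \<tau> where "\<tau> = inv_into A (rank_of A W) \<circ> rank_of A W'"
  note b = bij_betw_rank_of[OF assms(1,2)] and b' = bij_betw_rank_of[OF assms(1,3)]
  have bij: "bij_betw \<tau> A A"
    unfolding \<tau>_def using bij_betw_trans[OF b' bij_betw_inv_into[OF b]] .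
  have rk: "rank_of A W (\<tau> x) = rank_of A W' x" if "x \<in> A" for x
    unfolding \<tau>_def comp_def
    by (rule bij_betw_inv_into_right[OF b]) (use bij_betwE[OF b'] that in blast)
  have mem: "(\<tau> x, \<tau> y) \<in> W \<longleftrightarrow> (x, y) \<in> W'" if "x \<in> A" "y \<in> A" for x y
    using that rank_of_le_iff[OF assms(1,2), of "\<tau> x" "\<tau> y"] rank_of_le_iff[OF assms(1,3), of x y]
      rk bij_betwE[OF bij] by simp
  have "relabel A \<tau> W = W'"
    using mem rankings_subset[OF assms(3)] by (auto simp: relabel_def)
  with bij rk show ?thesis using that by blast
qed

lemma mallows_norm_const:
  assumes "finite A" "W \<in> rankings A" "W' \<in> rankings A"
  shows "mallows_norm A \<phi> W = mallows_norm A \<phi> W'"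
proof -
  obtain \<tau> where \<tau>: "bij_betw \<tau> A A" "relabel A \<tau> W = W'"
    using exists_relabelling[OF assms] by blast
  have "mallows_weight A \<phi> (rankings A) (relabel A \<tau> W) = mallows_weight A \<phi> (rankings A) W"
    using assms \<tau> by (intro mallows_weight_relabel) (auto simp: relabel_in_rankings)
  then show ?thesis by (simp add: \<tau> mallows_norm_def mallows_weight_def)
qed

lemma top_weight_const:
  assumes "finite A" "a \<in> A" "W \<in> top_rankings A a" "W' \<in> top_rankings A a"
  shows "mallows_weight A \<phi> (top_rankings A a) W = mallows_weight A \<phi> (top_rankings A a) W'"
proof -
  have R: "W \<in> rankings A" "W' \<in> rankings A" using assms by (simp_all add: top_rankings_iff)
  obtain \<tau> where \<tau>: "bij_betw \<tau> A A" "relabel A \<tau> W = W'"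
    "\<And>x. x \<in> A \<Longrightarrow> rank_of A W (\<tau> x) = rank_of A W' x"
    using exists_relabelling[OF assms(1) R] by blast
  have "rank_of A W (\<tau> a) = rank_of A W a"
    using \<tau>(3)[OF assms(2)] rank_of_top assms by metis
  then have \<tau>a: "\<tau> a = a"
    using bij_betw_rank_of[OF assms(1) R(1)] bij_betwE[OF \<tau>(1)] assms(2)
    by (auto simp: bij_betw_def inj_on_def)
  have "relabel A \<tau> ` top_rankings A a \<subseteq> top_rankings A a"
  proof clarify
    fix V assume V: "V \<in> top_rankings A a"
    have "(a, x) \<in> relabel A \<tau> V" if x: "x \<in> A" "x \<noteq> a" for x
    proof -
      have "\<tau> x \<in> A" "\<tau> x \<noteq> a"
        using x \<tau>a bij_betwE[OF \<tau>(1)] bij_betw_imp_inj_on[OF \<tau>(1)] assms(2)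
        by (auto simp: inj_on_def)
      then show ?thesis using V x assms(2) \<tau>a by (auto simp: relabel_def top_rankings_iff)
    qed
    then show "relabel A \<tau> V \<in> top_rankings A a"
      using V \<tau>(1) by (auto simp: top_rankings_iff relabel_in_rankings)
  qed
  then have "mallows_weight A \<phi> (top_rankings A a) (relabel A \<tau> W) =
      mallows_weight A \<phi> (top_rankings A a) W"
    using assms(1) \<tau>(1) R(1) by (intro mallows_weight_relabel) (auto simp: top_rankings_subset)
  then show ?thesis by (simp add: \<tau>)
qed

section \<open>Mallows expectations\<close>

lemma expectation_mallows:
  assumes "finite A" "0 < \<phi>" "W \<in> rankings A"
  shows "measure_pmf.expectation (mallows A \<phi> W) f =
    (\<Sum>V\<in>rankings A. f V * \<phi> ^ kendall_tau A V W) / mallows_norm A \<phi> W"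
proof -
  have "measure_pmf.expectation (mallows A \<phi> W) f = (\<Sum>V\<in>rankings A. f V * pmf (mallows A \<phi> W) V)"
    using assms by (intro integral_measure_pmf_real) (auto simp: finite_rankings set_pmf_mallows)
  then show ?thesis using assms by (simp add: pmf_mallows sum_divide_distrib)
qed

lemma mallows_norm_pos:
  assumes "finite A" "0 < \<phi>" "W \<in> rankings A"
  shows "0 < mallows_norm A \<phi> W"
  unfolding mallows_norm_def using assms finite_rankings[OF assms(1)] by (intro sum_pos) auto

lemma rankings_nonempty: "rankings A \<noteq> {}"
proof -
  obtain r where "well_order_on A r" using well_order_on by blast
  then show ?thesis by (auto simp: rankings_def well_order_on_def)
qed

text \<open>A null parameter \<open>h\<close> has \<open>a\<close> at some rank \<open>k > 0\<close>. Lifting \<open>a\<close> to the top brings \<open>h\<close> closer by \<open>k\<close>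
  to each ranking that has \<open>a\<close> on top, and the lifted parameter is an alternative.\<close>

lemma top_weight_null_le:
  assumes "finite A" "a \<in> A" "0 < \<phi>" "\<phi> < 1" "W \<in> top_rankings A a"
    "h \<in> rankings A" "h \<notin> top_rankings A a"
  shows "mallows_weight A \<phi> (top_rankings A a) h \<le> \<phi> * mallows_weight A \<phi> (top_rankings A a) W"
proof -
  have "0 < rank_of A h a"
  proof -
    obtain x where "x \<in> A" "(a, x) \<notin> h" using assms(6,7) by (auto simp: top_rankings_iff)
    then have "{y \<in> A. (a, y) \<notin> h} \<noteq> {}" by blast
    then show ?thesis unfolding rank_of_def using assms(1) by (simp add: card_gt_0_iff)
  qed
  then have "\<phi> ^ kendall_tau A V h \<le> \<phi> * \<phi> ^ kendall_tau A V (move_top A a h)"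
    if "V \<in> top_rankings A a" for V
    using kendall_tau_move_top[OF assms(1,2) that assms(6)] assms(3,4)
      power_decreasing[of "Suc (kendall_tau A V (move_top A a h))" "kendall_tau A V h" \<phi>] by simp
  then have "mallows_weight A \<phi> (top_rankings A a) h
      \<le> \<phi> * mallows_weight A \<phi> (top_rankings A a) (move_top A a h)"
    unfolding mallows_weight_def sum_distrib_left by (intro sum_mono)
  also have "\<dots> = \<phi> * mallows_weight A \<phi> (top_rankings A a) W"
    using top_weight_const[OF assms(1,2) move_top_in_top_rankings[OF assms(6,2)] assms(5)] by simp
  finally show ?thesis .
qed

section \<open>A competitor for each alternative\<close>

text \<open>The competitor tailored to the alternative \<open>W\<close>. It rejects whenever \<open>a\<close> is on top. In addition it
  rejects, with probability depending on the rank of \<open>c\<close>, on the rankings obtained from \<open>W\<close> by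
  lifting one other alternative \<open>c\<close> above \<open>a\<close>. Among the rankings led by \<open>c\<close> this one is
  closest to \<open>W\<close>. The support is sparse so that two of its members are far apart, hence no null parameter
  sees much of it.\<close>

definition sparse_test ::
    "'a set \<Rightarrow> 'a \<Rightarrow> (nat \<Rightarrow> real) \<Rightarrow> 'a rel \<Rightarrow> 'a rel \<Rightarrow> real" where
  "sparse_test A a x W V = of_bool (V \<in> top_rankings A a) +
     (\<Sum>c\<in>A - {a}. of_bool (V = move_top A c W) * x (rank_of A W c))"

lemma sum_sparse_test:
  assumes "finite A" "W \<in> rankings A"
  shows "(\<Sum>V\<in>rankings A. sparse_test A a x W V * F V) =
    (\<Sum>V\<in>top_rankings A a. F V) + (\<Sum>c\<in>A - {a}. x (rank_of A W c) * F (move_top A c W))"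
proof -
  have fin: "finite (rankings A)" by (rule finite_rankings[OF assms(1)])
  have "(\<Sum>V\<in>rankings A. sparse_test A a x W V * F V) =
     (\<Sum>V\<in>rankings A. of_bool (V \<in> top_rankings A a) * F V) +
     (\<Sum>V\<in>rankings A. \<Sum>c\<in>A - {a}. of_bool (V = move_top A c W) * (x (rank_of A W c) * F V))"
    by (simp add: sparse_test_def algebra_simps sum.distrib sum_distrib_left)
  also have "(\<Sum>V\<in>rankings A. of_bool (V \<in> top_rankings A a) * F V) = (\<Sum>V\<in>top_rankings A a. F V)"
    by (rule sum.mono_neutral_cong_right[OF fin top_rankings_subset]) auto
  also have "(\<Sum>V\<in>rankings A. \<Sum>c\<in>A - {a}. of_bool (V = move_top A c W) * (x (rank_of A W c) * F V))
    = (\<Sum>c\<in>A - {a}. \<Sum>V\<in>rankings A. of_bool (V = move_top A c W) * (x (rank_of A W c) * F V))"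
    by (rule sum.swap)
  also have "\<dots> = (\<Sum>c\<in>A - {a}. x (rank_of A W c) * F (move_top A c W))"
  proof (rule sum.cong[OF refl])
    fix c assume "c \<in> A - {a}"
    then have "move_top A c W \<in> rankings A" using assms(2) by (simp add: move_top_in_rankings)
    then show "(\<Sum>V\<in>rankings A. of_bool (V = move_top A c W) * (x (rank_of A W c) * F V)) =
        x (rank_of A W c) * F (move_top A c W)"
      using fin by (subst sum.remove[of _ "move_top A c W"]) (auto intro!: sum.neutral)
  qed
  finally show ?thesis .
qed

lemma top_rankings_disjoint:
  assumes "c \<in> A" "a \<in> A" "c \<noteq> a" "V \<in> top_rankings A c"
  shows "V \<notin> top_rankings A a"
  using assms rankings_antisym[of V A c a] by (auto simp: top_rankings_iff)

lemma is_test_sparse_test: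
  assumes "finite A" "a \<in> A" "W \<in> rankings A" "\<And>k. 0 \<le> x k" "\<And>k. x k \<le> 1"
  shows "is_test (rankings A) (sparse_test A a x W)"
  unfolding is_test_def
proof (intro ballI)
  fix V assume V: "V \<in> rankings A"
  let ?s = "\<Sum>c\<in>A - {a}. of_bool (V = move_top A c W) * x (rank_of A W c)"
  have s0: "0 \<le> ?s" using assms(4) by (intro sum_nonneg) simp
  have other: "V \<noteq> move_top A c' W" if "V \<in> top_rankings A c" "c \<in> A" "c' \<in> A" "c' \<noteq> c" for c c'
    using top_rankings_disjoint[of c' A c V] move_top_in_top_rankings[OF assms(3)] that by metis
  show "0 \<le> sparse_test A a x W V \<and> sparse_test A a x W V \<le> 1"
  proof (cases "\<exists>c\<in>A - {a}. V = move_top A c W")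
    case True
    then obtain c where c: "c \<in> A" "c \<noteq> a" "V = move_top A c W" by blast
    have Vc: "V \<in> top_rankings A c" using c move_top_in_top_rankings[OF assms(3)] by blast
    \<comment> \<open>The rankings \<open>move_top A c' W\<close> have different leaders, so only one term survives.\<close>
    have "?s = (\<Sum>c'\<in>{c}. of_bool (V = move_top A c' W) * x (rank_of A W c'))"
      using assms(1) c other[OF Vc c(1)] by (intro sum.mono_neutral_right) auto
    then have "?s = x (rank_of A W c)" using c(3) by simp
    then show ?thesis
      using top_rankings_disjoint[OF c(1) assms(2) c(2) Vc] assms(4,5) by (simp add: sparse_test_def)
  next
    case False
    then have "?s = 0" by (intro sum.neutral) auto
    then show ?thesis by (simp add: sparse_test_def)
  qed
qed

text \<open>If \<open>h\<close> is itself one of the lifted rankings, say the one for the rank \<open>k\<close>, it is at distance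
  at least \<open>k + l\<close> from the one for any other rank \<open>l\<close>; summing up gives the left-hand side of \<open>near\<close>.
  Any other \<open>h\<close> is at distance at least 1 from all of them, which leads to \<open>far\<close>.\<close>

lemma sparse_part_null_le:
  fixes \<phi> t :: real
  assumes "finite A" "a \<in> A" "0 < \<phi>" "\<phi> < 1" "W \<in> top_rankings A a"
    and h: "h \<in> rankings A"
    and x: "\<And>k. 0 \<le> x k"
    and near: "\<And>k. k \<in> {1..card A - 1} \<Longrightarrow>
      x k * (1 - \<phi> ^ (2 * k)) + \<phi> ^ k * (\<Sum>l=1..card A - 1. x l * \<phi> ^ l) \<le> t"
    and far: "\<phi> * (\<Sum>l=1..card A - 1. x l) \<le> t"
  shows "(\<Sum>c\<in>A - {a}. x (rank_of A W c) * \<phi> ^ kendall_tau A (move_top A c W) h) \<le> t"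
proof -
  have W: "W \<in> rankings A" using assms(5) by (simp add: top_rankings_iff)
  note bij = bij_betw_rank_of_top[OF assms(1,2,5)]
  show ?thesis
  proof (cases "\<exists>c\<in>A - {a}. h = move_top A c W")
    case True
    then obtain c where c: "c \<in> A - {a}" "h = move_top A c W" by blast
    let ?k = "rank_of A W"
    have "(\<Sum>c'\<in>A - {a}. x (?k c') * \<phi> ^ kendall_tau A (move_top A c' W) h) =
      x (?k c) + (\<Sum>c'\<in>A - {a} - {c}. x (?k c') * \<phi> ^ kendall_tau A (move_top A c' W) h)"
      using c assms(1) W by (subst sum.remove[of _ c])
        (auto simp: kendall_tau_self move_top_in_rankings)
    also have "\<dots> \<le> x (?k c) + (\<Sum>c'\<in>A - {a} - {c}. \<phi> ^ ?k c * (x (?k c') * \<phi> ^ ?k c'))"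
    proof (intro add_left_mono sum_mono)
      fix c' assume c': "c' \<in> A - {a} - {c}"
      have "\<phi> ^ kendall_tau A (move_top A c' W) h \<le> \<phi> ^ (?k c + ?k c')"
        using kendall_tau_move_top_move_top_ge[OF assms(1), of c' c W] c c' W assms(3,4)
        by (intro power_decreasing) (auto simp: add.commute)
      then show "x (?k c') * \<phi> ^ kendall_tau A (move_top A c' W) h \<le> \<phi> ^ ?k c * (x (?k c') * \<phi> ^ ?k c')"
        by (auto dest: mult_left_mono[OF _ x[of "?k c'"]] simp: power_add mult_ac)
    qed
    also have "(\<Sum>c'\<in>A - {a} - {c}. \<phi> ^ ?k c * (x (?k c') * \<phi> ^ ?k c')) =
        \<phi> ^ ?k c * ((\<Sum>c'\<in>A - {a}. x (?k c') * \<phi> ^ ?k c') - x (?k c) * \<phi> ^ ?k c)"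
      using c assms(1) by (subst sum.remove[of "A - {a}" c]) (auto simp: sum_distrib_left)
    also have "(\<Sum>c'\<in>A - {a}. x (?k c') * \<phi> ^ ?k c') = (\<Sum>l=1..card A - 1. x l * \<phi> ^ l)"
      by (rule sum.reindex_bij_betw[OF bij])
    also have "x (?k c) + \<phi> ^ ?k c * ((\<Sum>l=1..card A - 1. x l * \<phi> ^ l) - x (?k c) * \<phi> ^ ?k c) =
      x (?k c) * (1 - \<phi> ^ (2 * ?k c)) + \<phi> ^ ?k c * (\<Sum>l=1..card A - 1. x l * \<phi> ^ l)"
      by (simp add: algebra_simps mult_2 power_add)
    also have "\<dots> \<le> t" by (rule near[OF bij_betw_apply[OF bij c(1)]])
    finally show ?thesis .
  next
    case False
    have "(\<Sum>c\<in>A - {a}. x (rank_of A W c) * \<phi> ^ kendall_tau A (move_top A c W) h)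
      \<le> (\<Sum>c\<in>A - {a}. x (rank_of A W c) * \<phi>)"
    proof (intro sum_mono mult_left_mono x)
      fix c assume c: "c \<in> A - {a}"
      then have "kendall_tau A (move_top A c W) h \<noteq> 0"
        using False kendall_tau_eq_0_imp[OF assms(1) move_top_in_rankings[OF W] h, of c] by auto
      then show "\<phi> ^ kendall_tau A (move_top A c W) h \<le> \<phi>"
        using power_decreasing[of 1 "kendall_tau A (move_top A c W) h" \<phi>] assms(3,4) by simp
    qed
    also have "\<dots> = (\<Sum>l=1..card A - 1. x l * \<phi>)"
      by (rule sum.reindex_bij_betw[OF bij])
    also have "\<dots> \<le> t" using far by (simp add: sum_distrib_left mult.commute)
    finally show ?thesis .
  qed
qed

text \<open>The weights of the sparse part of the competitor. The constraints are those that keep its size within the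
  level. The last inequality says that the gain in power \<open>G = (\<Sum>l=1..n. x l * \<phi> ^ l)\<close> exceeds
  \<open>Y * t / (1 - \<phi>\<^sup>2 + \<phi> * Y)\<close>, the most that a single test can gain on average over the alternatives.\<close>

lemma exists_weights:
  fixes \<phi> :: real and n :: nat
  assumes "0 < \<phi>" "\<phi> < 1 / real (Suc n)" "n \<ge> 3"
  defines "Y \<equiv> \<Sum>k=1..n. \<phi> ^ k"
  obtains x :: "nat \<Rightarrow> real" and t :: real where
    "\<And>k. 0 \<le> x k" "\<And>k. x k \<le> 1" "0 < t" "t < 1"
    "\<And>k. k \<in> {1..n} \<Longrightarrow> x k * (1 - \<phi> ^ (2 * k)) + \<phi> ^ k * (\<Sum>l=1..n. x l * \<phi> ^ l) \<le> t"
    "\<phi> * (\<Sum>l=1..n. x l) \<le> t"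
    "Y * t < (\<Sum>l=1..n. x l * \<phi> ^ l) * (1 - \<phi>\<^sup>2 + \<phi> * Y)"
proof -
  have n1: "\<phi> * (real n + 1) < 1" using assms by (simp add: field_simps)
  have lt1: "\<phi> < 1"
  proof -
    have "\<phi> * 1 \<le> \<phi> * (real n + 1)" using assms by (intro mult_left_mono) auto
    then show ?thesis using n1 by simp
  qed
  \<comment> \<open>Equal weights \<open>1 / 2\<close> satisfy the constraint for \<open>k = 1\<close> with equality and the others
    strictly, and give \<open>Y * t = G * (1 - \<phi>\<^sup>2 + \<phi> * Y)\<close>, where \<open>G\<close> is the gain. Shifting some weight from
    \<open>k = 1\<close> to \<open>k = 2\<close> at the exchange rate \<open>\<phi> ^ 3\<close> keeps the tight constraint tight and
    increases the gain; \<open>\<delta>\<close> is small enough for the slack of the other constraints.\<close>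
  define \<delta> where "\<delta> = (\<phi> - \<phi>\<^sup>2) * \<phi> ^ 3 / 2"
  have sq: "\<phi>\<^sup>2 < \<phi>" using lt1 assms(1) by (simp add: power2_eq_square)
  have p1: "\<phi> ^ k \<le> 1" for k using assms(1) lt1 by (simp add: power_le_one)
  have p0: "0 < \<phi> ^ k" for k using assms(1) by simp
  have \<delta>0: "0 < \<delta>" using sq assms(1) by (simp add: \<delta>_def)
  have "(\<phi> - \<phi>\<^sup>2) * \<phi> ^ 3 \<le> 1 * 1"
    using sq lt1 p1[of 3] p0[of 3] p0[of 2] by (intro mult_mono) linarith+
  then have \<delta>1: "\<delta> \<le> 1" by (simp add: \<delta>_def)
  define e where "e = (\<lambda>k::nat. if k = 1 then - (\<phi> ^ 3 * \<delta>) else if k = 2 then \<delta> else 0)"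
  define x where "x = (\<lambda>k. (1 + e k) / 2)"
  define t where "t = (1 - \<phi>\<^sup>2 + \<phi> * Y) / 2"
  have set: "{1..n} = insert 1 (insert 2 {3..n})" using assms(3) by auto
  have e0: "(\<Sum>k=3..n. e k * h k) = 0" for h :: "nat \<Rightarrow> real"
    by (rule sum.neutral) (auto simp: e_def)
  have esum: "(\<Sum>k=1..n. e k * h k) = - (\<phi> ^ 3 * \<delta>) * h 1 + \<delta> * h 2" for h :: "nat \<Rightarrow> real"
    unfolding set using e0[of h] by (simp add: e_def)
  have G: "(\<Sum>l=1..n. x l * \<phi> ^ l) = (Y + \<delta> * (\<phi>\<^sup>2 - \<phi> ^ 4)) / 2"
  proof -
    have "(\<Sum>l=1..n. x l * \<phi> ^ l) = (Y + (\<Sum>l=1..n. e l * \<phi> ^ l)) / 2"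
      unfolding Y_def x_def
      by (simp add: sum_divide_distrib[symmetric] sum.distrib[symmetric] algebra_simps)
    also have "(\<Sum>l=1..n. e l * \<phi> ^ l) = \<delta> * (\<phi>\<^sup>2 - \<phi> ^ 4)"
      unfolding esum by (simp add: algebra_simps eval_nat_numeral)
    finally show ?thesis .
  qed
  have X: "(\<Sum>l=1..n. x l) = (real n + \<delta> * (1 - \<phi> ^ 3)) / 2"
  proof -
    have "(\<Sum>l=1..n. x l) = (real n + (\<Sum>l=1..n. e l * 1)) / 2"
      unfolding x_def by (simp add: sum_divide_distrib[symmetric] sum.distrib)
    then show ?thesis unfolding esum by (simp add: algebra_simps)
  qed
  have ek: "- 1 \<le> e k" "e k \<le> \<delta>" for k
  proof -
    have "\<phi> ^ 3 * \<delta> \<le> 1 * 1" using p1[of 3] \<delta>0 \<delta>1 by (intro mult_mono) linarith+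
    moreover have "0 < \<phi> ^ 3 * \<delta>" using p0 \<delta>0 by (intro mult_pos_pos)
    ultimately show "- 1 \<le> e k" "e k \<le> \<delta>" using \<delta>0 by (auto simp: e_def)
  qed
  \<comment> \<open>Some exponent besides \<open>1\<close> and \<open>k\<close> contributes to \<open>Y\<close>: this is where \<open>n \<ge> 3\<close> enters.\<close>
  have YA: "\<phi> + \<phi> ^ k + \<phi> ^ 3 \<le> Y" if "2 \<le> k" "k \<le> n" for k
  proof -
    define j :: nat where "j = (if k = 2 then 3 else 2)"
    have "(\<Sum>l\<in>{1, k, j}. \<phi> ^ l) \<le> Y"
      unfolding Y_def using that assms(1,3) by (intro sum_mono2) (auto simp: j_def)
    moreover have "(\<Sum>l\<in>{1, k, j}. \<phi> ^ l) = \<phi> + \<phi> ^ k + \<phi> ^ j"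
      using that by (auto simp: j_def)
    moreover have "\<phi> ^ 3 \<le> \<phi> ^ j"
      using assms(1) lt1 by (intro power_decreasing) (auto simp: j_def)
    ultimately show ?thesis by simp
  qed
  have Yge: "\<phi> \<le> Y" using YA[of 2] assms(3) p0[of 2] p0[of 3] by linarith
  have Yle: "Y \<le> 1"
  proof -
    have "Y \<le> (\<Sum>k=1..n. \<phi>)" unfolding Y_def
      using assms(1) lt1 power_decreasing[of 1 _ \<phi>] by (intro sum_mono) auto
    also have "\<dots> \<le> \<phi> * (real n + 1)" using assms(1) by (simp add: algebra_simps)
    finally show ?thesis using n1 by simp
  qed
  \<comment> \<open>The constraint on \<open>\<phi> * (\<Sum>l=1..n. x l)\<close> follows from \<open>\<phi> * (n + 1) / 2 \<le> t\<close>,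
    and \<open>\<phi> * (n + 1) < 1\<close>, so \<open>1 / 2 \<le> t\<close> suffices.\<close>
  have tge: "1 / 2 \<le> t"
  proof -
    have "\<phi> * \<phi> \<le> \<phi> * Y" using Yge assms(1) by simp
    then show ?thesis by (simp add: t_def power2_eq_square)
  qed
  show ?thesis
  proof (rule that[of x t])
    show "0 \<le> x k" "x k \<le> 1" for k
      using ek[of k] \<delta>1 by (auto simp: x_def)
    show "0 < t" using tge by simp
    have "\<phi> * Y \<le> \<phi> * 1" using Yle assms(1) by (intro mult_left_mono) auto
    moreover obtain q where "\<phi>\<^sup>2 = q" "0 < q" using p0[of 2] by blast
    ultimately show "t < 1" using lt1 by (simp add: t_def)
    have "\<phi> * (real n + \<delta> * (1 - \<phi> ^ 3)) \<le> \<phi> * (real n + 1)"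
    proof -
      have "\<delta> * (1 - \<phi> ^ 3) \<le> 1 * 1" using \<delta>0 \<delta>1 p0[of 3] p1[of 3] by (intro mult_mono) linarith+
      then show ?thesis using assms(1) by (intro mult_left_mono) auto
    qed
    then show "\<phi> * (\<Sum>l=1..n. x l) \<le> t" unfolding X using n1 tge by simp
    have "0 < \<phi>\<^sup>2 - \<phi> ^ 4"
      using power_strict_decreasing[of 2 4 \<phi>] assms(1) lt1 by simp
    then have gp: "0 < \<delta> * (\<phi>\<^sup>2 - \<phi> ^ 4)" using \<delta>0 by simp
    have "Y * t * 2 < (Y + \<delta> * (\<phi>\<^sup>2 - \<phi> ^ 4)) * (2 * t)"
      using mult_strict_right_mono[of Y "Y + \<delta> * (\<phi>\<^sup>2 - \<phi> ^ 4)" "2 * t"] gp tge by simp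
    then show "Y * t < (\<Sum>l=1..n. x l * \<phi> ^ l) * (1 - \<phi>\<^sup>2 + \<phi> * Y)"
      unfolding G t_def by (simp add: field_simps)
    have half: "u / 2 * w + p * (s / 2) \<le> v / 2" if "u * w + p * s \<le> v" for u w p s v :: real
      using that by simp
    fix k assume k: "k \<in> {1..n}"
    show "x k * (1 - \<phi> ^ (2 * k)) + \<phi> ^ k * (\<Sum>l=1..n. x l * \<phi> ^ l) \<le> t"
    proof (cases "k = 1")
      case True
      have "(1 - \<phi> ^ 3 * \<delta>) * (1 - \<phi>\<^sup>2) + \<phi> * (Y + \<delta> * (\<phi>\<^sup>2 - \<phi> ^ 4)) = 1 - \<phi>\<^sup>2 + \<phi> * Y"
        by (simp add: algebra_simps eval_nat_numeral)
      then have MM: "(1 - \<phi> ^ 3 * \<delta>) * (1 - \<phi> ^ (2 * k)) + \<phi> ^ k * (Y + \<delta> * (\<phi>\<^sup>2 - \<phi> ^ 4))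
          \<le> 1 - \<phi>\<^sup>2 + \<phi> * Y"
        by (simp add: True)
      have xk: "x k = (1 - \<phi> ^ 3 * \<delta>) / 2" by (simp add: x_def e_def True)
      show ?thesis unfolding G t_def xk by (rule half[OF MM])
    next
      case False
      then have k2: "2 \<le> k" "k \<le> n" using k by auto
      have "(\<phi> - \<phi>\<^sup>2) * \<phi> ^ 3 \<le> (\<phi> - \<phi> ^ k) * (Y - \<phi> - \<phi> ^ k)"
        using YA[OF k2] sq p0[of 3] power_decreasing[of 2 k \<phi>] k2 assms(1) lt1
        by (intro mult_mono) linarith+
      then have 1: "2 * \<delta> \<le> (\<phi> - \<phi> ^ k) * (Y - \<phi> - \<phi> ^ k)" by (simp add: \<delta>_def)
      have "e k * (1 - \<phi> ^ (2 * k)) \<le> \<delta> * (1 - \<phi> ^ (2 * k))"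
        using ek(2)[of k] p1[of "2 * k"] by (intro mult_right_mono) linarith+
      also have "\<dots> \<le> \<delta> * 1" using \<delta>0 p0[of "2 * k"] by (intro mult_left_mono) linarith+
      finally have 2: "e k * (1 - \<phi> ^ (2 * k)) \<le> \<delta>" by simp
      have "\<delta> * (\<phi>\<^sup>2 - \<phi> ^ 4) \<le> \<delta> * 1"
        using \<delta>0 p0[of 4] p1[of 2] by (intro mult_left_mono) linarith+
      moreover have "\<phi> ^ k * (\<delta> * (\<phi>\<^sup>2 - \<phi> ^ 4)) \<le> 1 * (\<delta> * (\<phi>\<^sup>2 - \<phi> ^ 4))"
        using gp p1[of k] by (intro mult_right_mono) linarith+
      ultimately have 3: "\<phi> ^ k * (\<delta> * (\<phi>\<^sup>2 - \<phi> ^ 4)) \<le> \<delta>" by linarith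
      have pk: "\<phi> ^ (2 * k) = \<phi> ^ k * \<phi> ^ k" by (simp add: mult_2 power_add)
      have "(1 + e k) * (1 - \<phi> ^ (2 * k)) + \<phi> ^ k * (Y + \<delta> * (\<phi>\<^sup>2 - \<phi> ^ 4)) =
        (1 - \<phi>\<^sup>2 + \<phi> * Y) - (\<phi> - \<phi> ^ k) * (Y - \<phi> - \<phi> ^ k)
         + e k * (1 - \<phi> ^ (2 * k)) + \<phi> ^ k * (\<delta> * (\<phi>\<^sup>2 - \<phi> ^ 4))"
        unfolding pk by (simp add: algebra_simps power2_eq_square)
      then have MM: "(1 + e k) * (1 - \<phi> ^ (2 * k)) + \<phi> ^ k * (Y + \<delta> * (\<phi>\<^sup>2 - \<phi> ^ 4)) \<le> 1 - \<phi>\<^sup>2 + \<phi> * Y"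
        using 1 2 3 by linarith
      have xk: "x k = (1 + e k) / 2" by (simp add: x_def)
      show ?thesis unfolding G t_def xk by (rule half[OF MM])
    qed
  qed
qed

section \<open>Null rankings with the favourite in second place\<close>

text \<open>A ranking is recovered from its restriction to \<open>A - {c}\<close>, which the lift preserves, by inserting \<open>c\<close>
  at its rank.\<close>

lemma move_top_rank_inj:
  assumes "finite A" "c \<in> A" "W \<in> rankings A" "W' \<in> rankings A"
    and mt: "move_top A c W = move_top A c W'" and rk: "rank_of A W c = rank_of A W' c"
  shows "W = W'"
proof -
  let ?B = "{y \<in> A. (c, y) \<notin> W}" and ?B' = "{y \<in> A. (c, y) \<notin> W'}"
  have agree: "(x, y) \<in> W \<longleftrightarrow> (x, y) \<in> W'" if "x \<noteq> c" "y \<noteq> c" for x y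
  proof -
    have "(x, y) \<in> move_top A c W \<longleftrightarrow> (x, y) \<in> move_top A c W'" using mt by simp
    then show ?thesis using that by (simp add: move_top_def)
  qed
  have fin: "finite ?B" "finite ?B'" using assms(1) by simp_all
  \<comment> \<open>Both sets are initial segments of one and the same ranking of \<open>A - {c}\<close>.\<close>
  have "?B \<subseteq> ?B' \<or> ?B' \<subseteq> ?B"
  proof (rule ccontr)
    assume "\<not> ?thesis"
    then obtain p q where p: "p \<in> A" "(c, p) \<notin> W" "(c, p) \<in> W'"
      and q: "q \<in> A" "(c, q) \<notin> W'" "(c, q) \<in> W" by blast
    have ne: "p \<noteq> c" "q \<noteq> c" 
      using p(2) q(2) rankings_refl[OF assms(3,2)] rankings_refl[OF assms(4,2)] by auto
    have "(q, c) \<in> W'" using rankings_total[OF assms(4,2) q(1,2)] .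
    then have "(q, p) \<in> W" using rankings_trans[OF assms(4) _ p(3)] agree[OF ne(2,1)] by simp
    moreover have "(p, c) \<in> W" using rankings_total[OF assms(3,2) p(1,2)] .
    ultimately have "(q, c) \<in> W" by (rule rankings_trans[OF assms(3)])
    then show False using rankings_antisym[OF assms(3) _ q(3)] ne(2) by simp
  qed
  moreover have "card ?B = card ?B'" using rk by (simp only: rank_of_def)
  ultimately have BB: "?B = ?B'"
    using card_subset_eq[OF fin(2), of ?B] card_subset_eq[OF fin(1), of ?B'] by argo
  have below: "(c, y) \<in> W \<longleftrightarrow> (c, y) \<in> W'" if "y \<in> A" for y
    using eqset_imp_iff[OF BB, of y] that by simp
  show ?thesis
  proof (rule rankings_eqI[OF assms(3,4)], rule subrelI)
    fix x y assume xy: "(x, y) \<in> W"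
    then have A: "x \<in> A" "y \<in> A" using rankings_subset[OF assms(3)] by blast+
    show "(x, y) \<in> W'"
    proof (cases "x = c")
      case True
      then show ?thesis using xy below[OF A(2)] by simp
    next
      case x: False
      show ?thesis
      proof (cases "y = c")
        case True
        have "(c, x) \<notin> W" using rankings_antisym[OF assms(3), of c x] xy True x by auto
        then show ?thesis using below[OF A(1)] rankings_total[OF assms(4,2) A(1)] True by simp
      next
        case False
        then show ?thesis using xy x agree[of x y] by simp
      qed
    qed
  qed
qed

text \<open>The null rankings that have \<open>a\<close> in second place. They are the null parameters hardest to distinguish from the
  alternatives, and the only ones used in the upper bound on the power.\<close>

definition runner_up_rankings :: "'a set \<Rightarrow> 'a \<Rightarrow> 'a rel set" where
  "runner_up_rankings A a = {move_top A c W | c W. c \<in> A - {a} \<and> W \<in> top_rankings A a}"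

lemma runner_up_in_null:
  assumes "a \<in> A" "U \<in> runner_up_rankings A a"
  shows "U \<in> rankings A - top_rankings A a"
proof -
  obtain c W where "U = move_top A c W" "c \<in> A" "c \<noteq> a" "W \<in> rankings A"
    using assms(2) by (auto simp: runner_up_rankings_def top_rankings_iff)
  then show ?thesis
    using move_top_in_top_rankings[of W A c] top_rankings_disjoint[of c A a U] assms(1)
    by (simp add: top_rankings_iff)
qed

lemma rank_of_runner_up:
  assumes "a \<in> A" "U \<in> runner_up_rankings A a"
  shows "rank_of A U a = 1"
proof -
  obtain c W where c: "U = move_top A c W" "c \<in> A" "c \<noteq> a" "W \<in> top_rankings A a"
    using assms(2) by (auto simp: runner_up_rankings_def)
  have "W \<in> rankings A" using c(4) by (simp add: top_rankings_iff)
  then have "{y \<in> A. (a, y) \<notin> U} = {c}"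
    using c assms(1) rankings_refl[of W A a] by (auto simp: move_top_def top_rankings_iff)
  then show ?thesis by (simp add: rank_of_def)
qed

text \<open>Here \<open>move_top A a (move_top A c W)\<close> starts with \<open>a, c\<close>, and \<open>move_top A c W\<close> with \<open>c, a\<close>.\<close>

lemma move_top_of_runner_up:
  assumes "a \<in> A" "c \<in> A" "c \<noteq> a" "W \<in> top_rankings A a"
  shows "rank_of A (move_top A a (move_top A c W)) c = 1"
    and "move_top A c (move_top A a (move_top A c W)) = move_top A c W"
proof -
  have W: "W \<in> rankings A" using assms(4) by (simp add: top_rankings_iff)
  have a: "(a, y) \<in> W" if "y \<in> A" for y
    using that assms(1,4) rankings_refl[OF W] by (auto simp: top_rankings_iff)
  have "{y \<in> A. (c, y) \<notin> move_top A a (move_top A c W)} = {a}"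
    using assms(1,3) by (auto simp: move_top_def)
  then show "rank_of A (move_top A a (move_top A c W)) c = 1" by (simp add: rank_of_def)
  have "x = a" if "(x, a) \<in> W" for x
    using that a[of x] rankings_antisym[OF W, of x a] rankings_subset[OF W] by auto
  then show "move_top A c (move_top A a (move_top A c W)) = move_top A c W"
    using a assms(1-3) by (auto simp: move_top_def)
qed

lemma inj_on_move_top_runner_up:
  assumes "finite A" "a \<in> A"
  shows "inj_on (move_top A a) (runner_up_rankings A a)"
proof (rule inj_onI)
  fix U U' assume U: "U \<in> runner_up_rankings A a" and U': "U' \<in> runner_up_rankings A a"
    and eq: "move_top A a U = move_top A a U'"
  obtain c W where c: "U = move_top A c W" "c \<in> A" "c \<noteq> a" "W \<in> top_rankings A a"
    using U by (auto simp: runner_up_rankings_def)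
  obtain c' W' where c': "U' = move_top A c' W'" "c' \<in> A" "c' \<noteq> a" "W' \<in> top_rankings A a"
    using U' by (auto simp: runner_up_rankings_def)
  let ?W = "move_top A a U"
  have R: "?W \<in> rankings A"
    using runner_up_in_null[OF assms(2) U] assms(2) by (simp add: move_top_in_rankings)
  \<comment> \<open>The leader of \<open>U\<close> is the alternative of rank 1 in \<open>?W\<close>, and lifting it back to the top gives \<open>U\<close>.\<close>
  have W: "rank_of A ?W c = 1" "move_top A c ?W = U"
    using move_top_of_runner_up[OF assms(2) c(2-4)] by (simp_all only: c(1))
  have W': "rank_of A ?W c' = 1" "move_top A c' ?W = U'"
    using move_top_of_runner_up[OF assms(2) c'(2-4)] by (simp_all only: c'(1) eq)
  have "c = c'"
    using bij_betw_imp_inj_on[OF bij_betw_rank_of[OF assms(1) R]] c(2) c'(2) W(1) W'(1)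
    by (simp add: inj_on_def)
  then show "U = U'" using W(2) W'(2) by simp
qed

lemma kendall_tau_runner_up_le:
  assumes "finite A" "a \<in> A" "U \<in> runner_up_rankings A a" "V \<in> rankings A"
  shows "kendall_tau A V U \<le> Suc (kendall_tau A V (move_top A a U))"
proof -
  have U: "U \<in> rankings A" using runner_up_in_null[OF assms(2,3)] by simp
  have "kendall_tau A V U \<le> kendall_tau A V (move_top A a U) + kendall_tau A (move_top A a U) U"
    using U assms(2) by (intro kendall_tau_triangle assms) (simp_all add: move_top_in_rankings)
  also have "kendall_tau A (move_top A a U) U = 1"
    using kendall_tau_move_top_self[OF assms(1,2) U] rank_of_runner_up[OF assms(2,3)] by simp
  finally show ?thesis by simp
qed

lemma rankings_have_top:
  assumes "finite A" "a \<in> A" "V \<in> rankings A"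
  obtains c where "c \<in> A" "V \<in> top_rankings A c"
proof -
  have "0 \<in> rank_of A V ` A"
    using bij_betw_rank_of[OF assms(1,3)] assms(1,2) by (auto simp: bij_betw_def card_gt_0_iff)
  then obtain c where c: "c \<in> A" "rank_of A V c = 0" by auto
  then have "{y \<in> A. (c, y) \<notin> V} = {}" using assms(1) by (simp add: rank_of_def)
  then show ?thesis using that[OF c(1)] assms(3) by (auto simp: top_rankings_iff)
qed

section \<open>An upper bound on the average power\<close>

text \<open>A sample point \<open>V\<close> outside the event that \<open>a\<close> is on top favours the averaged alternatives over the
  averaged null parameters by a factor of at most \<open>Y / (1 - \<phi>\<^sup>2 + \<phi> * Y)\<close>. The leader \<open>c\<close> of \<open>V\<close> decides:
  the null parameters \<open>U\<close> that are also led by \<open>c\<close> are closer to \<open>V\<close> than the matching alternatives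
  \<open>move_top A a U\<close>, the other ones at most one step further away, and \<open>Y\<close> times the weight of
  the former is at least the total weight of the alternatives.\<close>

lemma alternative_weight_le_null_weight:
  fixes \<phi> :: real
  assumes "finite A" "a \<in> A" "0 < \<phi>" "\<phi> < 1"
    and V: "V \<in> rankings A" "V \<notin> top_rankings A a"
  defines "Y \<equiv> \<Sum>k=1..card A - 1. \<phi> ^ k"
  shows "(\<Sum>U\<in>runner_up_rankings A a. \<phi> ^ kendall_tau A V (move_top A a U)) * (1 - \<phi>\<^sup>2 + \<phi> * Y)
    \<le> Y * (\<Sum>U\<in>runner_up_rankings A a. \<phi> ^ kendall_tau A V U)"
proof -
  obtain c where c: "c \<in> A" and Vc: "V \<in> top_rankings A c"
    using rankings_have_top[OF assms(1,2) V(1)] .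
  have ca: "c \<noteq> a" using Vc V by blast
  let ?N = "runner_up_rankings A a" and ?T = "top_rankings A a"
  let ?M = "move_top A c ` ?T"
  let ?D = "\<Sum>U\<in>?N. \<phi> ^ kendall_tau A V (move_top A a U)"
  let ?C = "\<Sum>U\<in>?N. \<phi> ^ kendall_tau A V U"
  let ?E = "\<Sum>U\<in>?M. \<phi> ^ kendall_tau A V U"
  have fT: "finite ?T" using finite_subset[OF top_rankings_subset finite_rankings[OF assms(1)]] .
  have TR: "W \<in> rankings A" if "W \<in> ?T" for W using that by (simp add: top_rankings_iff)
  have NR: "U \<in> rankings A" if "U \<in> ?N" for U using runner_up_in_null[OF assms(2) that] by simp
  have fN: "finite ?N" using NR finite_subset[OF _ finite_rankings[OF assms(1)]] by blast
  have MN: "?M \<subseteq> ?N" using c ca by (auto simp: runner_up_rankings_def)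
  have p0: "0 \<le> \<phi> ^ n" for n using assms(3) by simp
  \<comment> \<open>Lift \<open>c\<close> to the top of each alternative: the result lies in \<open>?M\<close>, each element of \<open>?M\<close> arises at
    most once for each former rank \<open>k\<close> of \<open>c\<close>, and the lift shortens the distance to \<open>V\<close> by \<open>k\<close>.\<close>
  have D_le: "?D \<le> Y * ?E"
  proof -
    have "?D = (\<Sum>W\<in>move_top A a ` ?N. \<phi> ^ kendall_tau A V W)"
      by (subst sum.reindex[OF inj_on_move_top_runner_up[OF assms(1,2)]]) (simp add: comp_def)
    also have "\<dots> \<le> (\<Sum>W\<in>?T. \<phi> ^ kendall_tau A V W)"
      using fT p0 NR move_top_in_top_rankings[OF _ assms(2)] by (intro sum_mono2) auto
    also have "\<dots> = (\<Sum>W\<in>?T. \<phi> ^ kendall_tau A V (move_top A c W) * \<phi> ^ rank_of A W c)"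
      by (rule sum.cong) (simp_all add: kendall_tau_move_top[OF assms(1) c Vc] TR power_add)
    also have "\<dots> = (\<Sum>(U, k)\<in>(\<lambda>W. (move_top A c W, rank_of A W c)) ` ?T.
        \<phi> ^ kendall_tau A V U * \<phi> ^ k)"
      using move_top_rank_inj[OF assms(1) c TR TR]
      by (subst sum.reindex) (auto simp: inj_on_def comp_def)
    also have "\<dots> \<le> (\<Sum>(U, k)\<in>?M \<times> {1..card A - 1}. \<phi> ^ kendall_tau A V U * \<phi> ^ k)"
    proof (rule sum_mono2)
      show "(\<lambda>W. (move_top A c W, rank_of A W c)) ` ?T \<subseteq> ?M \<times> {1..card A - 1}"
        using bij_betwE[OF bij_betw_rank_of_top[OF assms(1,2)]] c ca by blast
    qed (use fT p0 in auto)
    also have "\<dots> = Y * ?E"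
      unfolding Y_def by (simp add: sum.cartesian_product[symmetric] sum_product mult.commute
          sum.swap[of _ _ ?M])
    finally show ?thesis .
  qed
  \<comment> \<open>Exchanging \<open>a\<close> with the leader changes the distance to \<open>V\<close> by one: it brings the elements
    of \<open>?M\<close> one step closer than the corresponding alternatives, and takes the others at most one
    step further away.\<close>
  have C_ge: "(1 - \<phi>\<^sup>2) * ?E + \<phi> * ?D \<le> ?C"
  proof -
    have "?C = (\<Sum>U\<in>?N - ?M. \<phi> ^ kendall_tau A V U) + ?E"
      by (rule sum.subset_diff[OF MN fN])
    moreover have "?D = (\<Sum>U\<in>?N - ?M. \<phi> ^ kendall_tau A V (move_top A a U)) +
        (\<Sum>U\<in>?M. \<phi> ^ kendall_tau A V (move_top A a U))"
      by (rule sum.subset_diff[OF MN fN])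
    moreover have "\<phi> * (\<Sum>U\<in>?N - ?M. \<phi> ^ kendall_tau A V (move_top A a U))
      \<le> (\<Sum>U\<in>?N - ?M. \<phi> ^ kendall_tau A V U)"
      unfolding sum_distrib_left
    proof (rule sum_mono)
      fix U assume "U \<in> ?N - ?M"
      then show "\<phi> * \<phi> ^ kendall_tau A V (move_top A a U) \<le> \<phi> ^ kendall_tau A V U"
        using power_decreasing[OF kendall_tau_runner_up_le[OF assms(1,2) _ V(1)], of U \<phi>] assms(3,4)
        by simp
    qed
    moreover have "(\<Sum>U\<in>?M. \<phi> ^ kendall_tau A V (move_top A a U)) = \<phi> * ?E"
      unfolding sum_distrib_left
    proof (rule sum.cong[OF refl])
      fix U assume "U \<in> ?M"
      then obtain W where W: "W \<in> ?T" "U = move_top A c W" by blast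
      have "kendall_tau A V (move_top A a U) = Suc (kendall_tau A V U)"
        using kendall_tau_move_top[OF assms(1) c Vc, of "move_top A a U"]
          move_top_of_runner_up[OF assms(2) c ca W(1)] TR[OF W(1)] c assms(2)
        by (simp add: W(2) move_top_in_rankings)
      then show "\<phi> ^ kendall_tau A V (move_top A a U) = \<phi> * \<phi> ^ kendall_tau A V U" by simp
    qed
    ultimately show ?thesis by (simp add: algebra_simps power2_eq_square)
  qed
  have "0 \<le> Y" unfolding Y_def using p0 by (rule sum_nonneg)
  have "?D * (1 - \<phi>\<^sup>2 + \<phi> * Y) = (1 - \<phi>\<^sup>2) * ?D + Y * (\<phi> * ?D)" by (simp add: algebra_simps)
  also have "\<dots> \<le> (1 - \<phi>\<^sup>2) * (Y * ?E) + Y * (\<phi> * ?D)"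
    using D_le assms(3,4) by (intro add_right_mono mult_left_mono) (simp_all add: power_le_one)
  also have "\<dots> = Y * ((1 - \<phi>\<^sup>2) * ?E + \<phi> * ?D)" by (simp add: algebra_simps)
  also have "\<dots> \<le> Y * ?C" using C_ge \<open>0 \<le> Y\<close> by (rule mult_left_mono)
  finally show ?thesis .
qed

text \<open>The hypotheses \<open>size\<close> and \<open>power\<close> are summed over all null parameters \<open>U\<close> with \<open>a\<close> in second place and the
  matching alternatives \<open>move_top A a U\<close>. This replaces averaging \<open>f\<close> over all permutations
  of \<open>A - {a}\<close>, and it leaves a linear bound that can be checked at every sample point separately:
  outside \<open>top_rankings A a\<close> by the likelihood ratio bound above, inside with \<open>f V \<le> 1\<close>.\<close>

lemma test_power_gain_bound:
  fixes \<phi> z t G :: real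
  assumes "finite A" "a \<in> A" "0 < \<phi>" "\<phi> < 1" "runner_up_rankings A a \<noteq> {}"
    and f: "is_test (rankings A) f"
    and z: "\<And>W. W \<in> top_rankings A a \<Longrightarrow> mallows_weight A \<phi> (top_rankings A a) W = z"
    and size: "\<And>U. U \<in> runner_up_rankings A a \<Longrightarrow>
      (\<Sum>V\<in>rankings A. f V * \<phi> ^ kendall_tau A V U) \<le> \<phi> * z + t"
    and power: "\<And>W. W \<in> top_rankings A a \<Longrightarrow>
      z + G \<le> (\<Sum>V\<in>rankings A. f V * \<phi> ^ kendall_tau A V W)"
  defines "Y \<equiv> \<Sum>k=1..card A - 1. \<phi> ^ k"
  shows "G * (1 - \<phi>\<^sup>2 + \<phi> * Y) \<le> Y * t"
proof -
  let ?N = "runner_up_rankings A a" and ?T = "top_rankings A a" and ?R = "rankings A"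
  let ?q = "1 - \<phi>\<^sup>2 + \<phi> * Y"
  let ?D = "\<lambda>V. \<Sum>U\<in>?N. \<phi> ^ kendall_tau A V (move_top A a U)"
  let ?C = "\<lambda>V. \<Sum>U\<in>?N. \<phi> ^ kendall_tau A V U"
  have fR: "finite ?R" using finite_rankings[OF assms(1)] .
  have NR: "U \<in> ?R" if "U \<in> ?N" for U using runner_up_in_null[OF assms(2) that] by simp
  have NT: "move_top A a U \<in> ?T" if "U \<in> ?N" for U
    using move_top_in_top_rankings[OF NR[OF that] assms(2)] .
  have fN: "finite ?N" using NR finite_subset[OF _ fR] by (simp add: subset_eq)
  then have N: "0 < real (card ?N)" using assms(5) by (simp add: card_gt_0_iff)
  have sq: "0 \<le> 1 - \<phi>\<^sup>2" using assms(3,4) by (simp add: power_le_one)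
  have Y0: "0 \<le> Y" unfolding Y_def using assms(3) by (intro sum_nonneg) simp
  have q0: "0 \<le> ?q" using sq Y0 assms(3) by simp
  have D0: "0 \<le> ?D V" for V using assms(3) by (intro sum_nonneg) simp
  have f01: "0 \<le> f V" "f V \<le> 1" if "V \<in> ?R" for V using f that by (auto simp: is_test_def)
  \<comment> \<open>On \<open>?T\<close> the null weight \<open>?C V\<close> absorbs only the part \<open>\<phi> * Y\<close> of the factor \<open>?q\<close>; the rest,
    \<open>1 - \<phi>\<^sup>2\<close>, is bounded with \<open>f V \<le> 1\<close>.\<close>
  have pt: "?q * (f V * ?D V) \<le> Y * (f V * ?C V) + (if V \<in> ?T then (1 - \<phi>\<^sup>2) * ?D V else 0)"
    if V: "V \<in> ?R" for V
  proof (cases "V \<in> ?T")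
    case True
    have "\<phi> * ?D V \<le> ?C V"
      unfolding sum_distrib_left
    proof (rule sum_mono)
      fix U assume "U \<in> ?N"
      then show "\<phi> * \<phi> ^ kendall_tau A V (move_top A a U) \<le> \<phi> ^ kendall_tau A V U"
        using power_decreasing[OF kendall_tau_runner_up_le[OF assms(1,2) _ V], of U \<phi>] assms(3,4)
        by simp
    qed
    then have "(Y * f V) * (\<phi> * ?D V) \<le> (Y * f V) * ?C V"
      using Y0 f01(1)[OF V] by (intro mult_left_mono) simp_all
    moreover have "f V * ((1 - \<phi>\<^sup>2) * ?D V) \<le> 1 * ((1 - \<phi>\<^sup>2) * ?D V)"
      using f01(2)[OF V] sq D0 by (intro mult_right_mono mult_nonneg_nonneg)
    ultimately show ?thesis using True by (simp add: algebra_simps)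
  next
    case False
    have "?D V * ?q \<le> Y * ?C V"
      unfolding Y_def by (rule alternative_weight_le_null_weight[OF assms(1-4) V False])
    from mult_left_mono[OF this f01(1)[OF V]] show ?thesis using False by (simp add: mult_ac)
  qed
  have "?q * (real (card ?N) * (z + G))
      \<le> ?q * (\<Sum>U\<in>?N. \<Sum>V\<in>?R. f V * \<phi> ^ kendall_tau A V (move_top A a U))"
    using sum_bounded_below[of ?N "z + G", OF power[OF NT]] q0 by (intro mult_left_mono) simp_all
  also have "(\<Sum>U\<in>?N. \<Sum>V\<in>?R. f V * \<phi> ^ kendall_tau A V (move_top A a U)) = (\<Sum>V\<in>?R. f V * ?D V)"
    by (subst sum.swap) (simp add: sum_distrib_left)
  also have "?q * (\<Sum>V\<in>?R. f V * ?D V)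
      \<le> (\<Sum>V\<in>?R. Y * (f V * ?C V) + (if V \<in> ?T then (1 - \<phi>\<^sup>2) * ?D V else 0))"
    using pt by (subst sum_distrib_left) (rule sum_mono)
  also have "\<dots> = Y * (\<Sum>V\<in>?R. f V * ?C V) + (\<Sum>V\<in>?T. (1 - \<phi>\<^sup>2) * ?D V)"
  proof -
    have "(\<Sum>V\<in>?R. if V \<in> ?T then (1 - \<phi>\<^sup>2) * ?D V else 0) = (\<Sum>V\<in>?T. (1 - \<phi>\<^sup>2) * ?D V)"
      by (rule sum.mono_neutral_cong_right[OF fR top_rankings_subset]) auto
    then show ?thesis by (simp add: sum.distrib sum_distrib_left)
  qed
  also have "(\<Sum>V\<in>?R. f V * ?C V) = (\<Sum>U\<in>?N. \<Sum>V\<in>?R. f V * \<phi> ^ kendall_tau A V U)"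
    by (subst sum.swap) (simp add: sum_distrib_left)
  also have "(\<Sum>V\<in>?T. (1 - \<phi>\<^sup>2) * ?D V) = (1 - \<phi>\<^sup>2) * (real (card ?N) * z)"
  proof -
    have "(\<Sum>V\<in>?T. ?D V) = (\<Sum>U\<in>?N. mallows_weight A \<phi> ?T (move_top A a U))"
      unfolding mallows_weight_def by (rule sum.swap)
    also have "\<dots> = real (card ?N) * z" by (simp add: z NT)
    finally show ?thesis by (simp add: sum_distrib_left[symmetric])
  qed
  also have "Y * (\<Sum>U\<in>?N. \<Sum>V\<in>?R. f V * \<phi> ^ kendall_tau A V U) + (1 - \<phi>\<^sup>2) * (real (card ?N) * z)
      \<le> Y * (real (card ?N) * (\<phi> * z + t)) + (1 - \<phi>\<^sup>2) * (real (card ?N) * z)"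
    using sum_bounded_above[of ?N _ "\<phi> * z + t", OF size] Y0
    by (intro add_right_mono mult_left_mono) simp_all
  finally have "real (card ?N) * (G * ?q) \<le> real (card ?N) * (Y * t)"
    by (simp add: algebra_simps)
  then show ?thesis using N by simp
qed

section \<open>No uniformly most powerful test\<close>

theorem theorem4:
  fixes A :: "'a set" and m :: nat and a :: 'a and \<phi> :: real
  assumes "finite A" and "card A = m" and "m \<ge> 4" and "a \<in> A"
    and "0 < \<phi>" and "\<phi> < 1 / real m"
  shows "\<exists>\<alpha>::real. 0 < \<alpha> \<and> \<alpha> < 1 \<and>
    \<not> (\<exists>f. is_UMP_test (rankings A) (mallows A \<phi>)
              (rankings A - top_rankings A a) (top_rankings A a) \<alpha> f)"
proof -
  let ?R = "rankings A" and ?T = "top_rankings A a" and ?N = "runner_up_rankings A a"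
  define Y where "Y = (\<Sum>k=1..card A - 1. \<phi> ^ k)"
  have n: "\<phi> < 1 / real (Suc (card A - 1))" "3 \<le> card A - 1"
    using assms(2,3,6) by simp_all
  obtain x t where x: "\<And>k. 0 \<le> x k" "\<And>k. x k \<le> 1" and t: "0 < t" "t < 1"
    and near: "\<And>k. k \<in> {1..card A - 1} \<Longrightarrow>
      x k * (1 - \<phi> ^ (2 * k)) + \<phi> ^ k * (\<Sum>l=1..card A - 1. x l * \<phi> ^ l) \<le> t"
    and far: "\<phi> * (\<Sum>l=1..card A - 1. x l) \<le> t"
    and gain: "Y * t < (\<Sum>l=1..card A - 1. x l * \<phi> ^ l) * (1 - \<phi>\<^sup>2 + \<phi> * Y)"
    using exists_weights[OF assms(5) n] unfolding Y_def by blast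
  define G where "G = (\<Sum>l=1..card A - 1. x l * \<phi> ^ l)"
  have lt1: "\<phi> < 1"
    using assms(3,6) by (smt (verit) divide_le_eq_1 of_nat_le_iff of_nat_1 one_le_numeral order_trans)
  have fR: "finite ?R" using finite_rankings[OF assms(1)] .
  have fT: "finite ?T" using finite_subset[OF top_rankings_subset fR] .
  have TR: "W \<in> ?R" if "W \<in> ?T" for W using that by (simp add: top_rankings_iff)
  obtain W0 where W0: "W0 \<in> ?T"
    using rankings_nonempty[of A] move_top_in_top_rankings[OF _ assms(4)] by blast
  obtain b where b: "b \<in> A - {a}"
  proof -
    have "A \<noteq> {a}" using assms(2,3) by auto
    then show ?thesis using that assms(4) by blast
  qed
  define U0 where "U0 = move_top A b W0"
  have U0: "U0 \<in> ?N" using b W0 by (auto simp: U0_def runner_up_rankings_def)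
  define z where "z = mallows_weight A \<phi> ?T W0"
  define Z where "Z = mallows_norm A \<phi> W0"
  have z: "mallows_weight A \<phi> ?T W = z" if "W \<in> ?T" for W
    unfolding z_def by (rule top_weight_const[OF assms(1,4) that W0])
  have Z: "mallows_norm A \<phi> W = Z" if "W \<in> ?R" for W
    unfolding Z_def by (rule mallows_norm_const[OF assms(1) that TR[OF W0]])
  have Zpos: "0 < Z" unfolding Z_def by (rule mallows_norm_pos[OF assms(1,5) TR[OF W0]])
  have z0: "0 \<le> z" unfolding z_def mallows_weight_def using assms(5) by (intro sum_nonneg) simp
  have E: "measure_pmf.expectation (mallows A \<phi> W) g =
      (\<Sum>V\<in>?R. g V * \<phi> ^ kendall_tau A V W) / Z" if "W \<in> ?R" for W g
    using expectation_mallows[OF assms(1,5) that] Z[OF that] by simp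
  have U0R: "U0 \<in> ?R" "U0 \<notin> ?T" using runner_up_in_null[OF assms(4) U0] by simp_all
  have fN: "finite (?R - ?T)" "?R - ?T \<noteq> {}" using fR U0R by auto

  \<comment> \<open>Rejecting exactly on \<open>?T\<close> has size \<open>\<phi> * z / Z\<close>; the level leaves a budget \<open>t / Z\<close> beyond that.\<close>
  define \<alpha> where "\<alpha> = (\<phi> * z + t) / Z"
  have "\<phi> * z + 1 \<le> Z"
  proof -
    have "\<phi> * z \<le> (\<Sum>V\<in>?T. \<phi> ^ kendall_tau A V U0)"
      unfolding z[OF move_top_in_top_rankings[OF U0R(1) assms(4)], symmetric]
        mallows_weight_def sum_distrib_left
    proof (rule sum_mono)
      fix V assume "V \<in> ?T"
      then show "\<phi> * \<phi> ^ kendall_tau A V (move_top A a U0) \<le> \<phi> ^ kendall_tau A V U0"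
        using power_decreasing[OF kendall_tau_runner_up_le[OF assms(1,4) U0 TR], of V \<phi>]
          assms(5) lt1 by simp
    qed
    moreover have "(\<Sum>V\<in>?T. \<phi> ^ kendall_tau A V U0) + 1 = (\<Sum>V\<in>insert U0 ?T. \<phi> ^ kendall_tau A V U0)"
      using U0R fT by (simp add: kendall_tau_self)
    moreover have "\<dots> \<le> (\<Sum>V\<in>?R. \<phi> ^ kendall_tau A V U0)"
      using U0R assms(5) top_rankings_subset[of A a] by (intro sum_mono2 fR) auto
    ultimately show ?thesis using Z[OF U0R(1)] by (simp add: mallows_norm_def)
  qed
  then have "\<alpha> < 1" using t Zpos by (simp add: \<alpha>_def)
  moreover have "0 < \<alpha>" using t z0 assms(5) Zpos by (simp add: \<alpha>_def add_nonneg_pos)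
  moreover have False if UMP: "is_UMP_test ?R (mallows A \<phi>) (?R - ?T) ?T \<alpha> f" for f
  proof -
    have f: "is_test ?R f" "test_size (mallows A \<phi>) (?R - ?T) f = \<alpha>"
      and best: "\<And>W g. W \<in> ?T \<Longrightarrow> is_test ?R g \<Longrightarrow> test_size (mallows A \<phi>) (?R - ?T) g \<le> \<alpha> \<Longrightarrow>
        test_power (mallows A \<phi>) g W \<le> test_power (mallows A \<phi>) f W"
      using UMP by (auto simp: is_UMP_test_def)
    have "G * (1 - \<phi>\<^sup>2 + \<phi> * Y) \<le> Y * t"
      unfolding Y_def
    proof (rule test_power_gain_bound[OF assms(1,4,5) lt1 _ f(1) z])
      show "?N \<noteq> {}" using U0 by blast
      fix U assume "U \<in> ?N"
      then have U: "U \<in> ?R - ?T" by (rule runner_up_in_null[OF assms(4)])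
      have "size_at (mallows A \<phi>) f U \<le> \<alpha>"
        unfolding f(2)[symmetric] test_size_def
        by (rule cSUP_upper[OF U]) (simp add: fN)
      then show "(\<Sum>V\<in>?R. f V * \<phi> ^ kendall_tau A V U) \<le> \<phi> * z + t"
        using U E[of U f] Zpos by (simp add: size_at_def \<alpha>_def divide_le_cancel)
    next
      fix W assume W: "W \<in> ?T"
      note bij = bij_betw_rank_of_top[OF assms(1,4) W]
      let ?g = "sparse_test A a x W"
      have sum: "(\<Sum>V\<in>?R. ?g V * \<phi> ^ kendall_tau A V h) = mallows_weight A \<phi> ?T h +
          (\<Sum>c\<in>A - {a}. x (rank_of A W c) * \<phi> ^ kendall_tau A (move_top A c W) h)" for h
        unfolding mallows_weight_def by (rule sum_sparse_test[OF assms(1) TR[OF W]])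
      have "test_size (mallows A \<phi>) (?R - ?T) ?g \<le> \<alpha>"
        unfolding test_size_def
      proof (rule cSUP_least[OF fN(2)])
        fix h assume h: "h \<in> ?R - ?T"
        have "(\<Sum>V\<in>?R. ?g V * \<phi> ^ kendall_tau A V h) \<le> \<phi> * z + t"
          unfolding sum
        proof (rule add_mono)
          show "mallows_weight A \<phi> ?T h \<le> \<phi> * z"
            using top_weight_null_le[OF assms(1,4,5) lt1 W0, of h] h by (simp add: z_def)
          show "(\<Sum>c\<in>A - {a}. x (rank_of A W c) * \<phi> ^ kendall_tau A (move_top A c W) h) \<le> t"
            using h by (intro sparse_part_null_le[OF assms(1,4,5) lt1 W _ x(1) near far]) simp_all
        qed
        then show "size_at (mallows A \<phi>) ?g h \<le> \<alpha>"
          using h E[of h ?g] Zpos by (simp add: size_at_def \<alpha>_def divide_le_cancel)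
      qed
      then have "test_power (mallows A \<phi>) ?g W \<le> test_power (mallows A \<phi>) f W"
        by (rule best[OF W is_test_sparse_test[OF assms(1,4) TR[OF W] x]])
      then have le: "(\<Sum>V\<in>?R. ?g V * \<phi> ^ kendall_tau A V W) \<le> (\<Sum>V\<in>?R. f V * \<phi> ^ kendall_tau A V W)"
        using E[OF TR[OF W]] Zpos by (simp add: test_power_def divide_le_cancel)
      have "(\<Sum>c\<in>A - {a}. x (rank_of A W c) * \<phi> ^ kendall_tau A (move_top A c W) W) =
          (\<Sum>c\<in>A - {a}. x (rank_of A W c) * \<phi> ^ rank_of A W c)"
        by (rule sum.cong) (simp_all add: kendall_tau_move_top_self[OF assms(1) _ TR[OF W]])
      also have "\<dots> = G" unfolding G_def by (rule sum.reindex_bij_betw[OF bij])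
      finally show "z + G \<le> (\<Sum>V\<in>?R. f V * \<phi> ^ kendall_tau A V W)"
        using le by (simp add: sum z[OF W])
    qed
    then show False using gain by (simp add: G_def)
  qed
  ultimately show ?thesis by blast
qed

end
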